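(* Let $\mu,\nu\in P_2(\mathbb{R}^d)$. (i) For $k=1,2$: $$\mathcal{T}_2(\mu,\mathrm{P}^{cx}_{1,\le\nu})=\mathcal{T}_2(\mu,\mathrm{P}^{cx}_{2,\le\nu})=\sup_{\varphi\in\mathcal{A}_{cx}\cap C_{b,k}}\Big\{\int Q_2(\varphi)\,d\mu-\int\varphi\,d\nu\Big\}=\sup_{\varphi\in\mathcal{A}_{cx}\cap L^1(d\nu)}\Big\{\int Q_2(\varphi)\,d\mu-\int\varphi\,d\nu\Big\}.$$ (ii) For $k=1,2$: $$\mathcal{T}_2(\mathrm{P}^{cx}_{1,\mu\le},\nu)=\mathcal{T}_2(\mathrm{P}^{cx}_{2,\mu\le},\nu)=\sup_{\varphi\in\mathcal{A}_{cx}\cap C_{b,k}}\Big\{\int \varphi\,d\mu-\int Q_{\bar 2}(\varphi)\,d\nu\Big\}.$$ In (i) and (ii), $\varphi\in\mathcal{A}_{cx}\cap C_{b,k}$ may be replaced by $\varphi\in\mathcal{A}_{cx}\cap\mathrm{S}_{b,k}$ without changing the value.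
   Context: For $\mu,\nu\in P_1(\mathbb{R}^d)$, $\mu\le_{cx}\nu$ means $\int\varphi\,d\mu\le\int\varphi\,d\nu$ for every real-valued convex $\varphi$ for which both integrals exist in the extended sense. $\mathcal{A}_{cx}$ is the set of proper lower semicontinuous convex functions $\mathbb{R}^d\to\mathbb{R}\cup\{+\infty\}$. $P_k(\mathbb{R}^d)$: Borel probabilities with finite $k$-th moment. $\mathrm{P}^{cx}_{k,\le\nu}=\{\eta\in P_k(\mathbb{R}^d):\eta\le_{cx}\nu\}$, $\mathrm{P}^{cx}_{k,\mu\le}=\{\xi\in P_k(\mathbb{R}^d):\mu\le_{cx}\xi\}$. $\mathcal{T}_2(\mu,\eta)=\inf_{\pi\in\Pi(\mu,\eta)}\int|x-y|^2d\pi$, and $\mathcal{T}_2$ between a measure and a cone is the infimum over the cone. $C_{b,k}$ (resp. $\mathrm{S}_{b,k}$): continuous (resp. measurable) $u$ with $\sup_x|u(x)|/(1+|x|^k)<\infty$. $Q_2(\varphi)(x)=\inf_{y\in\mathbb{R}^d}\{\varphi(y)+|x-y|^2\}$, $Q_{\bar2}(\varphi)(y)=\sup_{x\in\mathbb{R}^d}\{\varphi(x)-|x-y|^2\}$. *)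

theory Defs
  imports "HOL-Probability.Probability"
begin

definition eint :: "'a measure \<Rightarrow> ('a \<Rightarrow> ereal) \<Rightarrow> ereal" where
  "eint M f = enn2ereal (\<integral>\<^sup>+ x. e2ennreal (f x) \<partial>M) - enn2ereal (\<integral>\<^sup>+ x. e2ennreal (- f x) \<partial>M)"

definition eint_exists :: "'a measure \<Rightarrow> ('a \<Rightarrow> ereal) \<Rightarrow> bool" where
  "eint_exists M f \<longleftrightarrow> f \<in> borel_measurable M \<and>
     ((\<integral>\<^sup>+ x. e2ennreal (f x) \<partial>M) < \<infinity> \<or> (\<integral>\<^sup>+ x. e2ennreal (- f x) \<partial>M) < \<infinity>)"

definition Pk :: "nat \<Rightarrow> ('a::euclidean_space) measure set" where
  "Pk k = {M. prob_space M \<and> sets M = sets borel \<and> integrable M (\<lambda>x. norm x ^ k)}"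

definition le_cx :: "('a::euclidean_space) measure \<Rightarrow> 'a measure \<Rightarrow> bool" where
  "le_cx \<mu> \<nu> \<longleftrightarrow> (\<forall>\<phi> :: 'a \<Rightarrow> real. convex_on UNIV \<phi> \<longrightarrow>
      eint_exists \<mu> (\<lambda>x. ereal (\<phi> x)) \<longrightarrow> eint_exists \<nu> (\<lambda>x. ereal (\<phi> x)) \<longrightarrow>
      eint \<mu> (\<lambda>x. ereal (\<phi> x)) \<le> eint \<nu> (\<lambda>x. ereal (\<phi> x)))"

definition cx_below :: "nat \<Rightarrow> ('a::euclidean_space) measure \<Rightarrow> 'a measure set" where
  "cx_below k \<nu> = {\<eta> \<in> Pk k. le_cx \<eta> \<nu>}"

definition cx_above :: "nat \<Rightarrow> ('a::euclidean_space) measure \<Rightarrow> 'a measure set" where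
  "cx_above k \<mu> = {\<xi> \<in> Pk k. le_cx \<mu> \<xi>}"

definition couplings :: "('a::euclidean_space) measure \<Rightarrow> 'a measure \<Rightarrow> ('a \<times> 'a) measure set" where
  "couplings \<mu> \<eta> = {\<pi>. prob_space \<pi> \<and> sets \<pi> = sets (borel :: ('a \<times> 'a) measure) \<and>
      distr \<pi> borel fst = \<mu> \<and> distr \<pi> borel snd = \<eta>}"

definition T2 :: "('a::euclidean_space) measure \<Rightarrow> 'a measure \<Rightarrow> ereal" where
  "T2 \<mu> \<eta> = (INF \<pi> \<in> couplings \<mu> \<eta>. enn2ereal (\<integral>\<^sup>+ p. ennreal ((norm (fst p - snd p))\<^sup>2) \<partial>\<pi>))"

definition T2_to_set :: "('a::euclidean_space) measure \<Rightarrow> 'a measure set \<Rightarrow> ereal" where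
  "T2_to_set \<mu> C = (INF \<eta> \<in> C. T2 \<mu> \<eta>)"

definition T2_from_set :: "('a::euclidean_space) measure set \<Rightarrow> 'a measure \<Rightarrow> ereal" where
  "T2_from_set C \<nu> = (INF \<xi> \<in> C. T2 \<xi> \<nu>)"

definition lsc :: "('a::topological_space \<Rightarrow> ereal) \<Rightarrow> bool" where
  "lsc f \<longleftrightarrow> (\<forall>x. f x \<le> Liminf (at x) f)"

definition convex_ext :: "('a::real_vector \<Rightarrow> ereal) \<Rightarrow> bool" where
  "convex_ext f \<longleftrightarrow> convex {(x, t::real). f x \<le> ereal t}"

definition Acx :: "('a::euclidean_space \<Rightarrow> ereal) set" where
  "Acx = {f. (\<forall>x. f x \<noteq> -\<infinity>) \<and> (\<exists>x. f x \<noteq> \<infinity>) \<and> lsc f \<and> convex_ext f}"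

definition Cbk :: "nat \<Rightarrow> ('a::euclidean_space \<Rightarrow> ereal) set" where
  "Cbk k = {f. (\<forall>x. \<bar>f x\<bar> \<noteq> \<infinity>) \<and> continuous_on UNIV (\<lambda>x. real_of_ereal (f x)) \<and>
      (\<exists>C. \<forall>x. \<bar>real_of_ereal (f x)\<bar> \<le> C * (1 + norm x ^ k))}"

definition Sbk :: "nat \<Rightarrow> ('a::euclidean_space \<Rightarrow> ereal) set" where
  "Sbk k = {f. (\<forall>x. \<bar>f x\<bar> \<noteq> \<infinity>) \<and> (\<lambda>x. real_of_ereal (f x)) \<in> borel_measurable borel \<and>
      (\<exists>C. \<forall>x. \<bar>real_of_ereal (f x)\<bar> \<le> C * (1 + norm x ^ k))}"

definition L1e :: "('a::euclidean_space) measure \<Rightarrow> ('a \<Rightarrow> ereal) set" where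
  "L1e \<nu> = {f. f \<in> borel_measurable \<nu> \<and> (\<integral>\<^sup>+ x. e2ennreal \<bar>f x\<bar> \<partial>\<nu>) < \<infinity>}"

definition Q2 :: "('a::euclidean_space \<Rightarrow> ereal) \<Rightarrow> 'a \<Rightarrow> ereal" where
  "Q2 \<phi> x = (INF y. \<phi> y + ereal ((norm (x - y))\<^sup>2))"

definition Q2bar :: "('a::euclidean_space \<Rightarrow> ereal) \<Rightarrow> 'a \<Rightarrow> ereal" where
  "Q2bar \<phi> y = (SUP x. \<phi> x - ereal ((norm (x - y))\<^sup>2))"

end

theory Submission
  imports Defs
begin

text \<open>
Weak duality is the pointwise bound between \<open>Q2 \<phi>\<close> (or \<open>Q2bar \<phi>\<close>) and the cost, integrated
against a coupling. For the converse only potentials \<open>\<phi>(z) = max\<^sub>i (a\<^sub>i \<bullet> z + b\<^sub>i)\<close> and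
\<open>\<psi>(x) = max\<^sub>i (a\<^sub>i \<bullet> x + b\<^sub>i - |a\<^sub>i|\<^sup>2 / 4)\<close> are needed: \<open>Q2 \<phi> \<ge> \<psi>\<close> and \<open>Q2bar \<psi> \<le> \<phi>\<close>, so both dual values
dominate \<open>\<integral> \<psi> d\<mu> - \<integral> \<phi> d\<nu>\<close>.

Cut \<open>\<mu>\<close> into finitely many small cells of masses \<open>m\<^sub>i\<close> and barycentres \<open>x\<^sub>i\<close>, and split
\<open>\<nu> = \<Sum>\<^sub>i f\<^sub>i \<nu>\<close> with \<open>f\<^sub>i \<ge> 0\<close>. If \<open>f\<close> nearly minimises
\<open>\<Sum>\<^sub>i m\<^sub>i |x\<^sub>i - u\<^sub>i / m\<^sub>i|\<^sup>2 + R \<Sum>\<^sub>i (q\<^sub>i - m\<^sub>i)\<^sup>2\<close>, where \<open>q\<^sub>i = \<integral> f\<^sub>i d\<nu>\<close> and \<open>u\<^sub>i = \<integral> z f\<^sub>i d\<nu>\<close>, then the first-order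
condition, tested on the splitting of \<open>\<nu>\<close> that selects the maximal affine function with slopes
\<open>a\<^sub>i = 2 (x\<^sub>i - u\<^sub>i / m\<^sub>i)\<close> and \<open>b\<^sub>i = 2 R (m\<^sub>i - q\<^sub>i)\<close>, bounds the cost by the dual value. As \<open>R\<close> grows the
masses become right. With \<open>X\<close>, \<open>Z\<close> coupled by the resulting kernel and \<open>Y = E[Z | X]\<close>, the law of
\<open>Y\<close> lies below \<open>\<nu>\<close> and the law of \<open>X + Z - Y\<close> lies above \<open>\<mu>\<close> in convex order, and both primal
problems are charged \<open>E|X - Y|\<^sup>2\<close>.
\<close>

section \<open>Extended integrals and convex functions\<close>

lemma eint_eq_integral:
  assumes "integrable M g" and "AE x in M. f x = ereal (g x)"
  shows "eint M f = ereal (integral\<^sup>L M g)"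
proof -
  have p: "(\<integral>\<^sup>+x. e2ennreal (f x) \<partial>M) = (\<integral>\<^sup>+x. ennreal (g x) \<partial>M)"
    using assms(2) by (intro nn_integral_cong_AE) auto
  have n: "(\<integral>\<^sup>+x. e2ennreal (- f x) \<partial>M) = (\<integral>\<^sup>+x. ennreal (- g x) \<partial>M)"
    using assms(2) by (intro nn_integral_cong_AE) auto
  have "(\<integral>\<^sup>+x. ennreal (g x) \<partial>M) \<noteq> \<infinity>" "(\<integral>\<^sup>+x. ennreal (- g x) \<partial>M) \<noteq> \<infinity>"
    using assms(1) unfolding real_integrable_def by auto
  then obtain a b where "(\<integral>\<^sup>+x. ennreal (g x) \<partial>M) = ennreal a" "0 \<le> a"
    "(\<integral>\<^sup>+x. ennreal (- g x) \<partial>M) = ennreal b" "0 \<le> b"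
    by (metis ennreal_cases infinity_ennreal_def)
  then show ?thesis
    unfolding eint_def p n real_lebesgue_integral_def[OF assms(1)]
    by (simp add: enn2ereal_ennreal)
qed

text \<open>The integrable minorant \<open>g\<close> bounds the negative part of \<open>f\<close>,
  so only the positive part can have an infinite integral. Where such an integral is subtracted or
  serves as an upper bound, the first case is trivial and the second is ordinary
  integration.\<close>

lemma eint_infinite_or_integrable:
  assumes f[measurable]: "f \<in> borel_measurable M" and g: "integrable M g"
    and le: "\<And>x. ereal (g x) \<le> f x"
  obtains "eint M f = \<infinity>"
  | "integrable M (\<lambda>x. real_of_ereal (f x))" "AE x in M. f x = ereal (real_of_ereal (f x))"
proof (cases "(\<integral>\<^sup>+x. e2ennreal (f x) \<partial>M) = \<infinity>")
  case True
  have "(\<integral>\<^sup>+x. e2ennreal (- f x) \<partial>M) \<le> (\<integral>\<^sup>+x. ennreal (- g x) \<partial>M)"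
  proof (intro nn_integral_mono)
    fix x
    have "- f x \<le> ereal (- g x)" using le[of x] by (cases "f x") auto
    from e2ennreal_mono[OF this] show "e2ennreal (- f x) \<le> ennreal (- g x)" by simp
  qed
  also have "\<dots> < \<infinity>" using g unfolding real_integrable_def by (simp add: less_top)
  finally have "enn2ereal (\<integral>\<^sup>+x. e2ennreal (- f x) \<partial>M) \<noteq> \<infinity>"
    by (metis e2ennreal_enn2ereal e2ennreal_infty infinity_ennreal_def less_irrefl)
  then have "eint M f = \<infinity>"
    unfolding eint_def True
    by (cases "enn2ereal (\<integral>\<^sup>+x. e2ennreal (- f x) \<partial>M)") auto
  then show ?thesis by (rule that(1))
next
  case False
  have nm: "f x \<noteq> -\<infinity>" for x using le[of x] by auto
  have "AE x in M. e2ennreal (f x) \<noteq> \<infinity>"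
    using False by (intro nn_integral_PInf_AE) auto
  then have fin: "AE x in M. f x = ereal (real_of_ereal (f x))"
  proof eventually_elim
    case (elim x)
    then show ?case using nm[of x] by (cases "f x") auto
  qed
  have "(\<integral>\<^sup>+x. ennreal (real_of_ereal (f x)) \<partial>M) = (\<integral>\<^sup>+x. e2ennreal (f x) \<partial>M)"
    using fin by (intro nn_integral_cong_AE) (auto elim!: eventually_mono, metis e2ennreal_ereal)
  moreover have "(\<integral>\<^sup>+x. ennreal (- real_of_ereal (f x)) \<partial>M) \<le> (\<integral>\<^sup>+x. ennreal (- g x) \<partial>M)"
    using fin
  proof (intro nn_integral_mono_AE, eventually_elim)
    case (elim x)
    have "ereal (g x) \<le> ereal (real_of_ereal (f x))" using le[of x] elim by simp
    then show ?case by (intro ennreal_leI) simp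
  qed
  moreover have "(\<integral>\<^sup>+x. ennreal (- g x) \<partial>M) < \<infinity>"
    using g unfolding real_integrable_def by (simp add: less_top)
  ultimately have "integrable M (\<lambda>x. real_of_ereal (f x))"
    using False unfolding real_integrable_def by (auto simp: top_unique)
  then show ?thesis using fin by (rule that(2))
qed

section \<open>Closed convex functions and their affine minorants\<close>

lemma lsc_eventually:
  assumes "lsc f" and "c < f x"
  shows "eventually (\<lambda>y. c < f y) (nhds x)"
  using assms unfolding lsc_def le_Liminf_iff eventually_at_filter
  by (auto elim!: allE[of _ x] allE[of _ c] elim: eventually_mono)

lemma closed_epigraph:
  fixes f :: "'a::topological_space \<Rightarrow> ereal"
  assumes "lsc f"
  shows "closed {(x, t::real). f x \<le> ereal t}"
  unfolding closed_def
proof (rule open_prod_intro)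
  fix p assume "p \<in> - {(x, t::real). f x \<le> ereal t}"
  then obtain x t where p: "p = (x, t)" and "\<not> f x \<le> ereal t" by auto
  from this(2) obtain s where s: "ereal t < ereal s" "ereal s < f x"
    by (metis ereal_dense2 not_le)
  obtain A where A: "open A" "x \<in> A" "\<And>y. y \<in> A \<Longrightarrow> ereal s < f y"
    using lsc_eventually[OF assms s(2)] unfolding eventually_nhds by auto
  have "A \<times> {..<s} \<subseteq> - {(x, t). f x \<le> ereal t}"
  proof (clarsimp)
    fix a b assume "a \<in> A" "b < s" "f a \<le> ereal b"
    then have "ereal s < ereal b" using A(3)[of a] by (meson less_le_trans)
    then show False using \<open>b < s\<close> by simp
  qed
  then show "\<exists>A B. open A \<and> open B \<and> p \<in> A \<times> B \<and> A \<times> B \<subseteq> - {(x, t). f x \<le> ereal t}"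
    using A s(1) p by (intro exI[of _ A] conjI exI[of _ "{..<s}"]) auto
qed

text \<open>Separate the closed convex epigraph from the point at height \<open>e\<close> below the
  graph. The normal has positive last coordinate \<open>s\<close>, because that point and the graph
  point above it lie on opposite sides; so the hyperplane is the graph of an affine function, and it
  nearly touches \<open>f\<close> at \<open>x0\<close>.\<close>

lemma affine_minorant:
  fixes f :: "'a::euclidean_space \<Rightarrow> ereal"
  assumes f: "f \<in> Acx" and t0: "f x0 = ereal t0" and e: "0 < e"
  obtains v c where "\<And>y. ereal (v \<bullet> y + c) \<le> f y" and "v \<bullet> x0 + c > t0 - e"
proof -
  define E where "E = {(x, t::real). f x \<le> ereal t}"
  have "convex E" "closed E"
    using f closed_epigraph[of f] by (auto simp: E_def Acx_def convex_ext_def)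
  moreover have "(x0, t0 - e) \<notin> E" using t0 e by (auto simp: E_def)
  ultimately obtain p b where p: "p \<bullet> (x0, t0 - e) < b" "\<And>q. q \<in> E \<Longrightarrow> p \<bullet> q > b"
    using separating_hyperplane_closed_point[of E "(x0, t0 - e)"] by metis
  obtain w s where ws: "p = (w, s)" by (cases p)
  have "(x0, t0) \<in> E" using t0 by (simp add: E_def)
  from p(2)[OF this] p(1) have "s * (t0 - e) < s * t0" by (simp add: ws)
  then have "0 < s * e" by (simp add: algebra_simps)
  with e have s: "s > 0" by (simp add: zero_less_mult_iff)
  define v c where "v = - (w /\<^sub>R s)" and "c = b / s"
  have vy: "v \<bullet> y + c = (b - w \<bullet> y) / s" for y
    using s by (simp add: v_def c_def field_simps)
  show ?thesis
  proof (rule that)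
    fix y
    \<comment> \<open>The value \<open>f y\<close> may be infinite, so it is tested through its real
      upper bounds, that is, through points of the epigraph.\<close>
    show "ereal (v \<bullet> y + c) \<le> f y"
    proof (rule ereal_le_real)
      fix z assume "f y \<le> ereal z"
      then have "(y, z) \<in> E" by (simp add: E_def)
      from p(2)[OF this] have "b - w \<bullet> y < s * z" by (simp add: ws)
      then have "(b - w \<bullet> y) / s \<le> z" using s by (simp add: pos_divide_le_eq mult.commute)
      then show "ereal (v \<bullet> y + c) \<le> ereal z" by (simp only: vy ereal_less_eq)
    qed
  next
    show "v \<bullet> x0 + c > t0 - e"
    proof -
      have "(t0 - e) * s < b - w \<bullet> x0" using p(1) by (simp add: ws algebra_simps)
      then show ?thesis unfolding vy using s by (simp only: pos_less_divide_eq)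
    qed
  qed
qed

text \<open>Finite convex functions on a Euclidean space are continuous, hence lower
  semicontinuous.\<close>

lemma convex_on_imp_Acx:
  fixes \<phi> :: "'a::euclidean_space \<Rightarrow> real"
  assumes "convex_on UNIV \<phi>"
  shows "(\<lambda>x. ereal (\<phi> x)) \<in> Acx"
proof -
  have "isCont \<phi> x" for x
    using convex_on_continuous[OF open_UNIV assms] by (simp add: continuous_on_eq_continuous_at)
  then have "lsc (\<lambda>x. ereal (\<phi> x))"
    unfolding lsc_def
    by (intro allI eq_refl lim_imp_Liminf[symmetric]) (auto simp: isCont_def)
  moreover have "convex_ext (\<lambda>x. ereal (\<phi> x))"
    using assms unfolding convex_ext_def convex_epigraph[symmetric] epigraph_def
    by (simp add: case_prod_unfold Collect_case_prod_Sigma)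
  ultimately show ?thesis by (simp add: Acx_def)
qed

lemma convex_on_of_Acx:
  fixes f :: "'a::euclidean_space \<Rightarrow> ereal"
  assumes "f \<in> Acx"
  shows "convex_on {x. f x \<noteq> \<infinity>} (\<lambda>x. real_of_ereal (f x))"
proof -
  have fin: "f x = ereal (real_of_ereal (f x))" if "f x \<noteq> \<infinity>" for x
    using that assms by (cases "f x") (auto simp: Acx_def)
  have E: "convex {(x, t::real). f x \<le> ereal t}"
    using assms by (auto simp: Acx_def convex_ext_def)
  have key: "f (u *\<^sub>R x + v *\<^sub>R y) \<le> ereal (u * real_of_ereal (f x) + v * real_of_ereal (f y))"
    if "f x \<noteq> \<infinity>" "f y \<noteq> \<infinity>" "0 \<le> u" "0 \<le> v" "u + v = 1" for x y u v
    using convexD[OF E, of "(x, real_of_ereal (f x))" "(y, real_of_ereal (f y))" u v] that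
    by (auto simp: fin[symmetric])
  show ?thesis
  proof (intro convex_on_def[THEN iffD2] conjI ballI allI impI)
    show "convex {x. f x \<noteq> \<infinity>}"
    proof (rule convexI)
      fix x y u v assume "x \<in> {x. f x \<noteq> \<infinity>}" "y \<in> {x. f x \<noteq> \<infinity>}" "0 \<le> (u::real)" "0 \<le> v" "u + v = 1"
      then show "u *\<^sub>R x + v *\<^sub>R y \<in> {x. f x \<noteq> \<infinity>}" using key[of x y u v] by auto
    qed
    fix x y u v assume *: "x \<in> {x. f x \<noteq> \<infinity>}" "y \<in> {x. f x \<noteq> \<infinity>}" "0 \<le> (u::real)" "0 \<le> v" "u + v = 1"
    then have "f (u *\<^sub>R x + v *\<^sub>R y) \<noteq> \<infinity>" using key[of x y u v] by auto
    then show "real_of_ereal (f (u *\<^sub>R x + v *\<^sub>R y)) \<le> u * real_of_ereal (f x) + v * real_of_ereal (f y)"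
      using key[of x y u v] * by (metis (mono_tags, lifting) ereal_less_eq(3) fin mem_Collect_eq)
  qed
qed

section \<open>Moments and couplings\<close>

lemma PkD:
  assumes "M \<in> Pk k"
  shows "prob_space M" "sets M = sets borel" "space M = UNIV" "integrable M (\<lambda>x. norm x ^ k)"
  using assms sets_eq_imp_space_eq[of M borel] by (auto simp: Pk_def)

lemma Pk_measurable:
  assumes "M \<in> Pk k"
  shows "f \<in> measurable M N \<longleftrightarrow> f \<in> measurable borel N"
  by (simp only: measurable_cong_sets[OF PkD(2)[OF assms] refl])

lemma power_le_one_plus_power:
  fixes r :: real
  assumes "0 \<le> r" "k \<le> l"
  shows "r ^ k \<le> 1 + r ^ l"
proof (cases "r \<le> 1")
  case True
  then have "r ^ k \<le> 1" using assms(1) by (intro power_le_one)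
  then show ?thesis using zero_le_power[OF assms(1), of l] by linarith
next
  case False
  then have "r ^ k \<le> r ^ l" using assms(2) by (intro power_increasing) auto
  then show ?thesis by simp
qed

lemma integrable_power1_of_power2:
  fixes M :: "('a::euclidean_space) measure"
  assumes "prob_space M" "sets M = sets borel" "integrable M (\<lambda>x. (norm x)\<^sup>2)"
  shows "integrable M (\<lambda>x. x)" "integrable M (\<lambda>x. norm x)"
proof -
  interpret prob_space M by fact
  have [measurable]: "(\<lambda>x. x) \<in> borel_measurable M"
    using measurable_ident_sets[OF assms(2)] by simp
  show "integrable M (\<lambda>x. x)"
  proof (rule Bochner_Integration.integrable_bound)
    show "integrable M (\<lambda>x. 1 + (norm x)\<^sup>2)" using assms(3) by simp
    have "norm x \<le> 1 + (norm x)\<^sup>2" for x :: 'a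
      using power_le_one_plus_power[of "norm x" 1 2] by simp
    then show "AE x in M. norm x \<le> norm (1 + (norm x)\<^sup>2)" by auto
  qed simp
  then show "integrable M (\<lambda>x. norm x)" by simp
qed

lemma Pk_mono: "Pk 2 \<subseteq> Pk 1"
  using integrable_power1_of_power2(2) by (auto simp: Pk_def)

lemma integrable_affine:
  fixes M :: "('a::euclidean_space) measure"
  assumes "M \<in> Pk 1"
  shows "integrable M (\<lambda>x. v \<bullet> x + c)"
proof -
  interpret prob_space M using PkD(1)[OF assms] .
  have [measurable]: "(\<lambda>x. x) \<in> borel_measurable M"
    using measurable_ident_sets[OF PkD(2)[OF assms]] by simp
  have "integrable M (\<lambda>x. x)"
    using PkD(4)[OF assms] by (simp add: integrable_norm_iff)
  then show ?thesis by simp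
qed

lemma integrable_quadratic_growth:
  fixes M :: "('a::euclidean_space) measure"
  assumes "M \<in> Pk 2" and "f \<in> borel_measurable borel"
    and "\<And>x. \<bar>f x\<bar> \<le> C * (1 + (norm x)\<^sup>2)"
  shows "integrable M f"
proof -
  interpret prob_space M using PkD(1)[OF assms(1)] .
  show ?thesis
  proof (rule Bochner_Integration.integrable_bound)
    show "integrable M (\<lambda>x. C * (1 + (norm x)\<^sup>2))"
      using PkD(4)[OF assms(1)] by simp
    show "f \<in> borel_measurable M"
      using assms(2) PkD(2)[OF assms(1)] by (simp cong: measurable_cong_sets)
    show "AE x in M. norm (f x) \<le> norm (C * (1 + (norm x)\<^sup>2))"
      using assms(3) by (auto intro!: AE_I2 intro: order_trans[OF _ abs_ge_self])
  qed
qed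

lemma couplings_measurable:
  assumes "\<pi> \<in> couplings \<mu> \<eta>"
  shows "fst \<in> measurable \<pi> borel" "snd \<in> measurable \<pi> borel"
proof -
  have s: "sets \<pi> = sets (borel \<Otimes>\<^sub>M borel)"
    using assms unfolding borel_prod by (simp add: couplings_def)
  show "fst \<in> measurable \<pi> borel" "snd \<in> measurable \<pi> borel"
    using measurable_fst measurable_snd by (simp_all add: measurable_cong_sets[OF s refl])
qed

lemma couplings_integral:
  fixes f :: "'a::euclidean_space \<Rightarrow> real"
  assumes \<pi>: "\<pi> \<in> couplings \<mu> \<eta>" and f: "f \<in> borel_measurable borel"
  shows "integrable \<mu> f \<longleftrightarrow> integrable \<pi> (\<lambda>p. f (fst p))"
    and "integrable \<eta> f \<longleftrightarrow> integrable \<pi> (\<lambda>p. f (snd p))"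
    and "integral\<^sup>L \<mu> f = (\<integral>p. f (fst p) \<partial>\<pi>)"
    and "integral\<^sup>L \<eta> f = (\<integral>p. f (snd p) \<partial>\<pi>)"
proof -
  note m = couplings_measurable[OF \<pi>]
  have \<mu>: "\<mu> = distr \<pi> borel fst" and \<eta>: "\<eta> = distr \<pi> borel snd"
    using \<pi> by (auto simp: couplings_def)
  show "integrable \<mu> f \<longleftrightarrow> integrable \<pi> (\<lambda>p. f (fst p))"
    unfolding \<mu> by (rule integrable_distr_eq[OF m(1) f])
  show "integral\<^sup>L \<mu> f = (\<integral>p. f (fst p) \<partial>\<pi>)"
    unfolding \<mu> by (rule integral_distr[OF m(1) f])
  show "integrable \<eta> f \<longleftrightarrow> integrable \<pi> (\<lambda>p. f (snd p))"
    unfolding \<eta> by (rule integrable_distr_eq[OF m(2) f])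
  show "integral\<^sup>L \<eta> f = (\<integral>p. f (snd p) \<partial>\<pi>)"
    unfolding \<eta> by (rule integral_distr[OF m(2) f])
qed

lemma norm_diff_square_le:
  fixes x y :: "'a::real_inner"
  shows "(norm y)\<^sup>2 \<le> 2 * (norm x)\<^sup>2 + 2 * (norm (x - y))\<^sup>2"
proof -
  have "0 \<le> (norm (2 *\<^sub>R x - y))\<^sup>2" by simp
  then show ?thesis
    by (simp add: power2_norm_eq_inner inner_diff_left inner_diff_right inner_commute algebra_simps)
qed

text \<open>With finite cost, \<open>norm_diff_square_le\<close> transfers the second moment between
  the marginals. In weak duality this moves an element of a first-moment cone into
  \<open>Pk 2\<close>; in strong duality it gives the second moment of the constructed dominating
  law.\<close>

lemma couplings_second_moment:
  fixes \<mu> \<eta> :: "('a::euclidean_space) measure"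
  assumes \<pi>: "\<pi> \<in> couplings \<mu> \<eta>" and c: "integrable \<pi> (\<lambda>p. (norm (fst p - snd p))\<^sup>2)"
  shows "integrable \<mu> (\<lambda>x. (norm x)\<^sup>2) \<longleftrightarrow> integrable \<eta> (\<lambda>x. (norm x)\<^sup>2)"
proof -
  note [measurable] = couplings_measurable[OF \<pi>]
  have e: "integrable \<mu> (\<lambda>x. (norm x)\<^sup>2) \<longleftrightarrow> integrable \<pi> (\<lambda>p. (norm (fst p))\<^sup>2)"
    "integrable \<eta> (\<lambda>x. (norm x)\<^sup>2) \<longleftrightarrow> integrable \<pi> (\<lambda>p. (norm (snd p))\<^sup>2)"
    by (rule couplings_integral[OF \<pi>]; measurable)+
  show ?thesis unfolding e
  proof
    assume "integrable \<pi> (\<lambda>p. (norm (fst p))\<^sup>2)"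
    with c have "integrable \<pi> (\<lambda>p. 2 * (norm (fst p))\<^sup>2 + 2 * (norm (fst p - snd p))\<^sup>2)" by simp
    then show "integrable \<pi> (\<lambda>p. (norm (snd p))\<^sup>2)"
      by (rule Bochner_Integration.integrable_bound) (auto intro: norm_diff_square_le)
  next
    assume "integrable \<pi> (\<lambda>p. (norm (snd p))\<^sup>2)"
    with c have "integrable \<pi> (\<lambda>p. 2 * (norm (snd p))\<^sup>2 + 2 * (norm (fst p - snd p))\<^sup>2)" by simp
    then show "integrable \<pi> (\<lambda>p. (norm (fst p))\<^sup>2)"
      by (rule Bochner_Integration.integrable_bound)
        (auto intro!: norm_diff_square_le[THEN order_trans] simp: norm_minus_commute)
  qed
qed

lemma couplings_cost_cases:
  fixes \<mu> \<eta> :: "('a::euclidean_space) measure"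
  assumes \<pi>: "\<pi> \<in> couplings \<mu> \<eta>"
  obtains "enn2ereal (\<integral>\<^sup>+ p. ennreal ((norm (fst p - snd p))\<^sup>2) \<partial>\<pi>) = \<infinity>"
  | "integrable \<pi> (\<lambda>p. (norm (fst p - snd p))\<^sup>2)"
    "enn2ereal (\<integral>\<^sup>+ p. ennreal ((norm (fst p - snd p))\<^sup>2) \<partial>\<pi>) = ereal (\<integral>p. (norm (fst p - snd p))\<^sup>2 \<partial>\<pi>)"
proof (cases "(\<integral>\<^sup>+ p. ennreal ((norm (fst p - snd p))\<^sup>2) \<partial>\<pi>) = \<infinity>")
  case True
  then show ?thesis using that(1) by simp
next
  case False
  note [measurable] = couplings_measurable[OF \<pi>]
  have i: "integrable \<pi> (\<lambda>p. (norm (fst p - snd p))\<^sup>2)"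
    using False by (intro integrableI_nonneg) (auto simp: less_top)
  show ?thesis
    by (rule that(2)[OF i]) (simp add: nn_integral_eq_integral[OF i] enn2ereal_ennreal)
qed

section \<open>Weak duality\<close>

lemma continuous_on_plus_ereal:
  "continuous_on UNIV g \<Longrightarrow> continuous_on UNIV (\<lambda>x. c + ereal (g x))"
  by (cases c) (auto intro!: continuous_intros)

text \<open>The infimum is uncountable and \<open>\<phi>\<close> arbitrary, but every strict
  sublevel set is a union of open sets, one for each \<open>y\<close>.\<close>

lemma Q2_measurable: "Q2 \<phi> \<in> borel_measurable borel"
proof (rule borel_measurableI_less)
  fix c
  have "{x. Q2 \<phi> x < c} = (\<Union>y. {x. \<phi> y + ereal ((norm (x - y))\<^sup>2) < c})"
    by (auto simp: Q2_def INF_less_iff)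
  also have "open \<dots>"
    by (intro open_UN ballI open_Collect_less continuous_on_plus_ereal continuous_intros)
  finally show "{x \<in> space borel. Q2 \<phi> x < c} \<in> sets borel" by simp
qed

lemma Q2bar_measurable: "Q2bar \<phi> \<in> borel_measurable borel"
proof (rule borel_measurableI_greater)
  fix c
  have "{y. c < Q2bar \<phi> y} = (\<Union>x. {y. c < \<phi> x + ereal (- (norm (x - y))\<^sup>2)})"
    by (auto simp: Q2bar_def less_SUP_iff minus_ereal_def)
  also have "open \<dots>"
    by (intro open_UN ballI open_Collect_less continuous_on_plus_ereal continuous_intros)
  finally show "{y \<in> space borel. c < Q2bar \<phi> y} \<in> sets borel" by simp
qed

text \<open>Completing the square in \<open>v - (2 * k) *\<^sub>R (x - y)\<close>. For
  \<open>k = 1\<close> the subtracted constant is the loss of an affine function with slope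
  \<open>v\<close> under \<open>Q2\<close>.\<close>

lemma inner_le_quadratic:
  fixes v x y :: "'a::real_inner"
  assumes "k > 0"
  shows "v \<bullet> x - (norm v)\<^sup>2 / (4 * k) \<le> v \<bullet> y + k * (norm (x - y))\<^sup>2"
proof -
  have "0 \<le> (norm (v - (2 * k) *\<^sub>R (x - y)))\<^sup>2 / (4 * k)" using assms by simp
  also have "(norm (v - (2 * k) *\<^sub>R (x - y)))\<^sup>2
      = (norm v)\<^sup>2 - 4 * k * (v \<bullet> (x - y)) + 4 * k * (k * (norm (x - y))\<^sup>2)"
    unfolding power2_norm_eq_inner inner_diff_left inner_diff_right
    by (simp add: inner_commute algebra_simps)
  also have "\<dots> / (4 * k) = (norm v)\<^sup>2 / (4 * k) - v \<bullet> (x - y) + k * (norm (x - y))\<^sup>2"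
    using assms by (simp add: field_simps)
  finally show ?thesis by (simp add: inner_diff_right)
qed

lemma norm_square_convex:
  fixes a b :: "'a::real_inner"
  assumes "0 \<le> u" "0 \<le> v" "u + v = (1::real)"
  shows "(norm (u *\<^sub>R a + v *\<^sub>R b))\<^sup>2 \<le> u * (norm a)\<^sup>2 + v * (norm b)\<^sup>2"
proof -
  have v: "v = 1 - u" using assms by simp
  have "0 \<le> u * v * (norm (a - b))\<^sup>2" using assms by simp
  also have "\<dots> = u * (norm a)\<^sup>2 + v * (norm b)\<^sup>2 - (norm (u *\<^sub>R a + v *\<^sub>R b))\<^sup>2"
    unfolding power2_norm_eq_inner inner_diff_left inner_diff_right inner_add_left inner_add_right v
    by (simp add: inner_commute algebra_simps)
  finally show ?thesis by simp
qed

text \<open>Near-minimisers for the two points, combined with the same weights, give a competitor at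
  the combined point, and both \<open>F\<close> and the squared norm are convex along the
  combination. The slack \<open>e\<close> is there because the infimum over \<open>D\<close> may not
  be attained.\<close>

lemma convex_on_inf_convolution:
  fixes F :: "'a::real_inner \<Rightarrow> real"
  assumes F: "convex_on D F" and D: "D \<noteq> {}" and n: "n \<ge> 0"
    and bdd: "\<And>x. bdd_below ((\<lambda>y. F y + n * (norm (x - y))\<^sup>2) ` D)"
  shows "convex_on UNIV (\<lambda>x. INF y\<in>D. F y + n * (norm (x - y))\<^sup>2)"
    (is "convex_on UNIV ?m")
proof (rule convex_on_def[THEN iffD2], intro conjI ballI allI impI convex_UNIV)
  fix x w :: 'a and u v :: real
  assume uv: "0 \<le> u" "0 \<le> v" "u + v = 1"
  show "?m (u *\<^sub>R x + v *\<^sub>R w) \<le> u * ?m x + v * ?m w"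
  proof (rule field_le_epsilon)
    fix e :: real assume e: "e > 0"
    obtain y where y: "y \<in> D" "F y + n * (norm (x - y))\<^sup>2 < ?m x + e"
      using e D by (metis (no_types, lifting) bdd cINF_less_iff less_add_same_cancel1)
    obtain z where z: "z \<in> D" "F z + n * (norm (w - z))\<^sup>2 < ?m w + e"
      using e D by (metis (no_types, lifting) bdd cINF_less_iff less_add_same_cancel1)
    have "?m (u *\<^sub>R x + v *\<^sub>R w)
        \<le> F (u *\<^sub>R y + v *\<^sub>R z) + n * (norm (u *\<^sub>R x + v *\<^sub>R w - (u *\<^sub>R y + v *\<^sub>R z)))\<^sup>2"
      using F y(1) z(1) uv by (intro cINF_lower bdd) (auto simp: convex_on_def convex_def)
    also have "u *\<^sub>R x + v *\<^sub>R w - (u *\<^sub>R y + v *\<^sub>R z) = u *\<^sub>R (x - y) + v *\<^sub>R (w - z)"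
      by (simp add: algebra_simps)
    also have "n * (norm (u *\<^sub>R (x - y) + v *\<^sub>R (w - z)))\<^sup>2
        \<le> n * (u * (norm (x - y))\<^sup>2 + v * (norm (w - z))\<^sup>2)"
      using n uv by (intro mult_left_mono norm_square_convex)
    also have "F (u *\<^sub>R y + v *\<^sub>R z) \<le> u * F y + v * F z"
      using F y(1) z(1) uv by (auto simp: convex_on_def)
    finally have "?m (u *\<^sub>R x + v *\<^sub>R w)
        \<le> u * (F y + n * (norm (x - y))\<^sup>2) + v * (F z + n * (norm (w - z))\<^sup>2)"
      by (simp add: algebra_simps)
    also have "\<dots> \<le> u * (?m x + e) + v * (?m w + e)"
      using mult_left_mono[OF less_imp_le[OF y(2)] uv(1)] mult_left_mono[OF less_imp_le[OF z(2)] uv(2)]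
      by (rule add_mono)
    also have "\<dots> = u * ?m x + v * ?m w + (u + v) * e" by (simp only: algebra_simps)
    finally show "?m (u *\<^sub>R x + v *\<^sub>R w) \<le> u * ?m x + v * ?m w + e" using uv by simp
  qed
qed

lemma le_cx_integral:
  assumes "le_cx \<mu> \<nu>" "convex_on UNIV f" "integrable \<mu> f" "integrable \<nu> f"
  shows "integral\<^sup>L \<mu> f \<le> integral\<^sup>L \<nu> f"
proof -
  have "eint_exists M (\<lambda>x. ereal (f x))" if "integrable M f" for M
    using that unfolding eint_exists_def real_integrable_def by (auto simp: less_top)
  moreover have "eint M (\<lambda>x. ereal (f x)) = ereal (integral\<^sup>L M f)" if "integrable M f" for M
    using that by (intro eint_eq_integral) auto
  ultimately show ?thesis using assms unfolding le_cx_def by (metis ereal_less_eq(3))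
qed

text \<open>With \<open>n = (2 - l) / l\<close>, the minimum over \<open>y\<close> of the right side
  is \<open>n / (n + 1)\<close> times the squared distance from \<open>x\<close> to
  \<open>z\<close>, and \<open>n / (n + 1) = 1 - l / 2\<close>.\<close>

lemma mult_norm_square_split_le:
  fixes x y z :: "'a::real_inner"
  assumes l: "0 < l" "l < (1::real)"
  shows "(1 - l / 2) * (norm (x - z))\<^sup>2
    \<le> (2 - l) / l * (norm (y - z))\<^sup>2 + (norm (x - y))\<^sup>2"
proof -
  define n where "n = (2 - l) / l"
  have n: "n > 0" using l by (simp add: n_def)
  define a b where "a = x - y" and "b = y - z"
  have "0 \<le> (norm (n *\<^sub>R b - a))\<^sup>2" by simp
  also have "\<dots> = (n + 1) * (n * (norm b)\<^sup>2 + (norm a)\<^sup>2) - n * (norm (a + b))\<^sup>2"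
    unfolding power2_norm_eq_inner inner_diff_left inner_diff_right inner_add_left inner_add_right
    by (simp add: inner_commute algebra_simps)
  finally have "n * (norm (a + b))\<^sup>2 / (n + 1) \<le> n * (norm b)\<^sup>2 + (norm a)\<^sup>2"
    using n by (simp add: pos_divide_le_eq mult.commute)
  moreover have "n / (n + 1) = 1 - l / 2" using l by (simp add: n_def field_simps)
  then have "n * (norm (a + b))\<^sup>2 / (n + 1) = (1 - l / 2) * (norm (a + b))\<^sup>2"
    by (metis times_divide_eq_left)
  ultimately show ?thesis by (simp add: a_def b_def n_def)
qed

text \<open>The pointwise bound on \<open>Q2 \<phi>\<close>, integrated against
  \<open>\<pi>\<close>, leaves an integral of the potential over \<open>\<eta>\<close>, which convex
  order should bound by one over \<open>\<nu>\<close>. As \<open>\<phi>\<close> may be infinite, the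
  estimate is made with a real-valued convex minorant and a factor \<open>1 - l\<close> on the left,
  and then \<open>l\<close> tends to 0.\<close>

lemma weak_duality_below:
  fixes \<mu> \<nu> :: "('a::euclidean_space) measure"
  assumes \<mu>: "\<mu> \<in> Pk 2" and \<nu>: "\<nu> \<in> Pk 2" and \<eta>: "\<eta> \<in> cx_below 1 \<nu>" and \<phi>: "\<phi> \<in> Acx \<inter> L1e \<nu>"
    and \<pi>: "\<pi> \<in> couplings \<mu> \<eta>"
  shows "eint \<mu> (Q2 \<phi>) - eint \<nu> \<phi>
    \<le> enn2ereal (\<integral>\<^sup>+ p. ennreal ((norm (fst p - snd p))\<^sup>2) \<partial>\<pi>)"
  using \<pi>
proof (cases rule: couplings_cost_cases)
  case 2
  note cost = 2
  interpret \<pi>: prob_space \<pi> using \<pi> by (simp add: couplings_def)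
  define D where "D = {x. \<phi> x \<noteq> \<infinity>}"
  define F where "F = (\<lambda>x. real_of_ereal (\<phi> x))"
  define q where "q = (\<lambda>x. real_of_ereal (Q2 \<phi> x))"
  have A: "\<phi> \<in> Acx" using \<phi> by simp
  have F: "\<phi> x = ereal (F x)" if "x \<in> D" for x
    using that A by (cases "\<phi> x") (auto simp: Acx_def D_def F_def)
  obtain x0 where x0: "x0 \<in> D" using A by (auto simp: Acx_def D_def)
  obtain v c where vc: "\<And>y. ereal (v \<bullet> y + c) \<le> \<phi> y"
    using affine_minorant[OF A F[OF x0] zero_less_one] by metis
  have vcF: "v \<bullet> y + c \<le> F y" if "y \<in> D" for y using vc[of y] F[OF that] by simp
  \<comment> \<open>The affine minorant of \<open>\<phi>\<close> survives the addition of a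
    quadratic term at the price of a constant. This serves with \<open>k = 1\<close> for
    \<open>Q2 \<phi>\<close>, with \<open>k = n\<close> for \<open>m\<close>, and with
    \<open>k = 1/2\<close> for the remainder of weight \<open>l\<close>.\<close>
  have low: "v \<bullet> x + c - (norm v)\<^sup>2 / (4 * k) \<le> F y + k * (norm (x - y))\<^sup>2"
    if "y \<in> D" "k > 0" for x y k
    using inner_le_quadratic[OF that(2), of v x y] vcF[OF that(1)] by linarith
  have Q_le: "Q2 \<phi> x \<le> ereal (F y + (norm (x - y))\<^sup>2)" if "y \<in> D" for x y
    unfolding Q2_def using F[OF that] by (intro INF_lower2[of y]) auto
  have Q_ge: "ereal (v \<bullet> x + c - (norm v)\<^sup>2 / 4) \<le> Q2 \<phi> x" for x
    unfolding Q2_def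
  proof (rule INF_greatest)
    fix y
    show "ereal (v \<bullet> x + c - (norm v)\<^sup>2 / 4) \<le> \<phi> y + ereal ((norm (x - y))\<^sup>2)"
      using low[of y 1 x] F[of y] by (cases "y \<in> D") (auto simp: D_def)
  qed
  have q: "Q2 \<phi> x = ereal (q x)" for x
    using Q_le[OF x0, of x] Q_ge[of x] by (cases "Q2 \<phi> x") (auto simp: q_def)
  have q_le: "q x \<le> F y + (norm (x - y))\<^sup>2" if "y \<in> D" for x y
    using Q_le[OF that, of x] by (simp add: q)
  have q_ge: "v \<bullet> x + c - (norm v)\<^sup>2 / 4 \<le> q x" for x
    using Q_ge[of x] by (simp add: q)
  have qm: "q \<in> borel_measurable borel"
    unfolding q_def by (intro borel_measurable_real_of_ereal Q2_measurable)
  have \<mu>1: "\<mu> \<in> Pk 1" and \<nu>1: "\<nu> \<in> Pk 1" using \<mu> \<nu> Pk_mono by auto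
  have \<eta>1: "\<eta> \<in> Pk 1" and cx: "le_cx \<eta> \<nu>" using \<eta> by (auto simp: cx_below_def)
  have \<eta>2: "\<eta> \<in> Pk 2"
    using couplings_second_moment[OF \<pi> cost(1)] PkD[OF \<mu>] PkD[OF \<eta>1] by (simp add: Pk_def)
  have qi: "integrable \<mu> q"
  proof (rule Bochner_Integration.integrable_bound)
    show "integrable \<mu> (\<lambda>x. \<bar>v \<bullet> x + (c - (norm v)\<^sup>2 / 4)\<bar> + (\<bar>F x0\<bar> + (2 * (norm x0)\<^sup>2 + 2 * (norm x)\<^sup>2)))"
    proof -
      interpret prob_space \<mu> using PkD(1)[OF \<mu>] .
      show ?thesis
        using integrable_abs[OF integrable_affine[OF \<mu>1, of v "c - (norm v)\<^sup>2 / 4"]] PkD(4)[OF \<mu>]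
        by (intro Bochner_Integration.integrable_add) simp_all
    qed
    show "q \<in> borel_measurable \<mu>"
      using qm PkD(2)[OF \<mu>] by (simp cong: measurable_cong_sets)
    show "AE x in \<mu>. norm (q x) \<le> norm (\<bar>v \<bullet> x + (c - (norm v)\<^sup>2 / 4)\<bar> + (\<bar>F x0\<bar> + (2 * (norm x0)\<^sup>2 + 2 * (norm x)\<^sup>2)))"
    proof (rule AE_I2)
      fix x
      have "(norm (x - x0))\<^sup>2 \<le> 2 * (norm x0)\<^sup>2 + 2 * (norm x)\<^sup>2"
        using norm_diff_square_le[of "x - x0" x] by simp
      then show "norm (q x) \<le> norm (\<bar>v \<bullet> x + (c - (norm v)\<^sup>2 / 4)\<bar> + (\<bar>F x0\<bar> + (2 * (norm x0)\<^sup>2 + 2 * (norm x)\<^sup>2)))"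
        using q_le[OF x0, of x] q_ge[of x] zero_le_power2[of "norm x"] zero_le_power2[of "norm x0"]
          abs_ge_self[of "F x0"] abs_ge_minus_self[of "v \<bullet> x + (c - (norm v)\<^sup>2 / 4)"]
          abs_ge_zero[of "v \<bullet> x + (c - (norm v)\<^sup>2 / 4)"] abs_ge_zero[of "F x0"]
        unfolding real_norm_def by (intro order_trans[OF abs_leI abs_ge_self]; linarith)
    qed
  qed
  have Qint: "eint \<mu> (Q2 \<phi>) = ereal (integral\<^sup>L \<mu> q)"
    using qi by (intro eint_eq_integral) (auto simp: q)
  have \<phi>m: "\<phi> \<in> borel_measurable \<nu>" using \<phi> by (simp add: L1e_def)
  show ?thesis
    using \<phi>m integrable_affine[OF \<nu>1] vc
  proof (cases rule: eint_infinite_or_integrable)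
    case 1
    then show ?thesis by (simp add: Qint)
  next
    case 2
    have F\<nu>: "integrable \<nu> F" "AE x in \<nu>. \<phi> x = ereal (F x)"
      using 2 by (simp_all add: F_def)
    let ?C = "\<integral>p. (norm (fst p - snd p))\<^sup>2 \<partial>\<pi>"
    \<comment> \<open>The constant \<open>(norm v)\<^sup>2 / 2\<close> is the loss in
      \<open>low\<close> for \<open>k = 1/2\<close>.\<close>
    define K where "K = (\<integral>x. v \<bullet> x + (c - (norm v)\<^sup>2 / 2) \<partial>\<mu>)"
    have *: "(1 - l) * integral\<^sup>L \<mu> q + l * K \<le> integral\<^sup>L \<nu> F + ?C" if l: "0 < l" "l < 1" for l
    proof -
      define n where "n = (2 - l) / l"
      have n: "n > 0" using l by (simp add: n_def)
      \<comment> \<open>\<open>le_cx\<close> only tests real-valued convex functions, so \<open>\<phi>\<close> is replaced by its inf-convolution with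
        \<open>n |\<cdot>|\<^sup>2\<close>; since \<open>n / (n + 1) = 1 - l / 2\<close>, this costs \<open>Q2\<close> only an error of order \<open>l\<close>.\<close>
      define m where "m = (\<lambda>x. INF y\<in>D. F y + n * (norm (x - y))\<^sup>2)"
      have bdd: "bdd_below ((\<lambda>y. F y + n * (norm (x - y))\<^sup>2) ` D)" for x
        using low[OF _ n] by (intro bdd_belowI2[where m = "v \<bullet> x + c - (norm v)\<^sup>2 / (4 * n)"]) auto
      have mconv: "convex_on UNIV m"
        unfolding m_def using convex_on_of_Acx[OF A] x0 n bdd
        by (intro convex_on_inf_convolution) (auto simp: D_def F_def)
      have mm: "m \<in> borel_measurable borel"
        using convex_on_continuous[OF open_UNIV mconv] by (rule borel_measurable_continuous_onI)
      have m_le: "m x \<le> F y + n * (norm (x - y))\<^sup>2" if "y \<in> D" for x y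
        unfolding m_def using bdd that by (intro cINF_lower)
      have m_ge: "v \<bullet> x + c - (norm v)\<^sup>2 / (4 * n) \<le> m x" for x
        unfolding m_def using low[OF _ n] x0 by (intro cINF_greatest) auto
      have mi: "integrable M m" if M: "M \<in> Pk 2" for M
      proof (rule integrable_quadratic_growth[OF M mm])
        fix x
        have "(norm (x - x0))\<^sup>2 \<le> 2 * (norm x0)\<^sup>2 + 2 * (norm x)\<^sup>2"
          using norm_diff_square_le[of "x - x0" x] by simp
        then have "n * (norm (x - x0))\<^sup>2 \<le> n * (2 * (norm x0)\<^sup>2 + 2 * (norm x)\<^sup>2)"
          using n by (intro mult_left_mono) auto
        then have up: "m x \<le> \<bar>F x0\<bar> + 2 * n * (norm x0)\<^sup>2 + 2 * n * (norm x)\<^sup>2"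
          using m_le[OF x0, of x] by (simp add: algebra_simps)
        have "\<bar>v \<bullet> x\<bar> \<le> norm v * norm x" by (rule Cauchy_Schwarz_ineq2)
        also have "\<dots> \<le> (norm v)\<^sup>2 + (norm x)\<^sup>2"
          using sum_squares_bound[of "norm v" "norm x"] mult_nonneg_nonneg[OF norm_ge_zero[of v] norm_ge_zero[of x]]
          by linarith
        finally have "- m x \<le> (norm v)\<^sup>2 + (norm x)\<^sup>2 + \<bar>c\<bar> + (norm v)\<^sup>2 / (4 * n)"
          using m_ge[of x] by linarith
        moreover have "0 \<le> (norm v)\<^sup>2 / (4 * n)" "0 \<le> n * (norm x0)\<^sup>2" "0 \<le> n * (norm x)\<^sup>2" using n by auto
        ultimately have "\<bar>m x\<bar> \<le> (\<bar>F x0\<bar> + 2 * n * (norm x0)\<^sup>2 + (norm v)\<^sup>2 + \<bar>c\<bar> + (norm v)\<^sup>2 / (4 * n)) + (2 * n + 1) * (norm x)\<^sup>2"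
          using up zero_le_power2[of "norm v"] zero_le_power2[of "norm x"] abs_ge_zero[of c] abs_ge_zero[of "F x0"]
          unfolding distrib_right mult.assoc mult_1 by (intro abs_leI; linarith)
        also have "\<dots> \<le> ((\<bar>F x0\<bar> + 2 * n * (norm x0)\<^sup>2 + (norm v)\<^sup>2 + \<bar>c\<bar> + (norm v)\<^sup>2 / (4 * n)) + (2 * n + 1)) * (1 + (norm x)\<^sup>2)"
        proof -
          have "a + b * s \<le> (a + b) * (1 + s)" if "0 \<le> a" "0 \<le> b" "0 \<le> s" for a b s :: real
            using that by (simp add: algebra_simps)
          then show ?thesis using n by (auto intro!: add_nonneg_nonneg)
        qed
        finally show "\<bar>m x\<bar> \<le> ((\<bar>F x0\<bar> + 2 * n * (norm x0)\<^sup>2 + (norm v)\<^sup>2 + \<bar>c\<bar> + (norm v)\<^sup>2 / (4 * n)) + (2 * n + 1)) * (1 + (norm x)\<^sup>2)" .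
      qed
      \<comment> \<open>Write \<open>F z\<close> as \<open>(1 - l) * F z + l * F z\<close>. The
        first share is bounded below through \<open>q\<close> with the full squared distance, the
        second through the affine minorant with half of it. Together they use the factor
        \<open>1 - l / 2\<close>, which \<open>mult_norm_square_split_le\<close> divides between the
        infimum defining \<open>m y\<close> and the transport cost.\<close>
      have pt: "(1 - l) * q x + l * (v \<bullet> x + (c - (norm v)\<^sup>2 / 2)) \<le> m y + (norm (x - y))\<^sup>2" for x y
      proof -
        have "(1 - l) * q x + l * (v \<bullet> x + (c - (norm v)\<^sup>2 / 2)) - (norm (x - y))\<^sup>2 \<le> F z + n * (norm (y - z))\<^sup>2"
          if z: "z \<in> D" for z
        proof -
          have "(1 - l) * q x \<le> (1 - l) * (F z + (norm (x - z))\<^sup>2)"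
            using q_le[OF z, of x] l by (intro mult_left_mono) auto
          moreover have "l * (v \<bullet> x + (c - (norm v)\<^sup>2 / 2)) \<le> l * (F z + 1/2 * (norm (x - z))\<^sup>2)"
            using low[OF z, of "1/2" x] l by (intro mult_left_mono) auto
          moreover have "(1 - l) * (F z + (norm (x - z))\<^sup>2) + l * (F z + 1/2 * (norm (x - z))\<^sup>2)
              = F z + (1 - l / 2) * (norm (x - z))\<^sup>2"
            by (simp add: algebra_simps)
          ultimately show ?thesis
            using mult_norm_square_split_le[OF l, of x z y] by (simp add: n_def)
        qed
        then have "(1 - l) * q x + l * (v \<bullet> x + (c - (norm v)\<^sup>2 / 2)) - (norm (x - y))\<^sup>2 \<le> m y"
          unfolding m_def using x0 by (intro cINF_greatest) auto
        then show ?thesis by simp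
      qed
      have m\<pi>: "integrable \<pi> (\<lambda>p. m (snd p))" and m\<pi>': "integral\<^sup>L \<eta> m = (\<integral>p. m (snd p) \<partial>\<pi>)"
        using couplings_integral[OF \<pi> mm] mi[OF \<eta>2] by auto
      have lm: "(\<lambda>x. (1 - l) * q x + l * (v \<bullet> x + (c - (norm v)\<^sup>2 / 2))) \<in> borel_measurable borel"
        using qm by measurable
      have li: "integrable \<mu> (\<lambda>x. (1 - l) * q x + l * (v \<bullet> x + (c - (norm v)\<^sup>2 / 2)))"
        using qi integrable_affine[OF \<mu>1, of v "c - (norm v)\<^sup>2 / 2"]
        by (intro Bochner_Integration.integrable_add[OF integrable_mult_right integrable_mult_right])
      have "(1 - l) * integral\<^sup>L \<mu> q + l * K
          = (\<integral>x. (1 - l) * q x + l * (v \<bullet> x + (c - (norm v)\<^sup>2 / 2)) \<partial>\<mu>)"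
        unfolding K_def using qi integrable_affine[OF \<mu>1, of v "c - (norm v)\<^sup>2 / 2"]
        by (simp only: Bochner_Integration.integral_add[OF integrable_mult_right[OF qi]
              integrable_mult_right[OF integrable_affine[OF \<mu>1]]] integral_mult_right_zero)
      also have "\<dots> = (\<integral>p. (1 - l) * q (fst p) + l * (v \<bullet> fst p + (c - (norm v)\<^sup>2 / 2)) \<partial>\<pi>)"
        by (rule couplings_integral(3)[OF \<pi> lm])
      also have "\<dots> \<le> (\<integral>p. m (snd p) + (norm (fst p - snd p))\<^sup>2 \<partial>\<pi>)"
        using m\<pi> cost(1) li pt
        by (intro integral_mono Bochner_Integration.integrable_add[OF m\<pi> cost(1)]
              couplings_integral(1)[OF \<pi> lm, THEN iffD1])
      also have "\<dots> = integral\<^sup>L \<eta> m + ?C"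
        using m\<pi> cost(1) m\<pi>' by simp
      also have "integral\<^sup>L \<eta> m \<le> integral\<^sup>L \<nu> m"
        by (rule le_cx_integral[OF cx mconv mi[OF \<eta>2] mi[OF \<nu>]])
      also have "integral\<^sup>L \<nu> m \<le> integral\<^sup>L \<nu> F"
      proof (rule integral_mono_AE[OF mi[OF \<nu>] F\<nu>(1)])
        \<comment> \<open>Taking the point itself as competitor gives the bound wherever
          \<open>\<phi>\<close> is finite, hence almost everywhere for \<open>\<nu>\<close>.\<close>
        show "AE x in \<nu>. m x \<le> F x"
          using F\<nu>(2)
        proof eventually_elim
          case (elim x)
          then have "x \<in> D" by (auto simp: D_def)
          from m_le[OF this, of x] show ?case by simp
        qed
      qed
      finally show ?thesis by simp
    qed
    \<comment> \<open>Let \<open>l\<close> decrease to 0; neither \<open>K\<close> nor the right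
      side depends on \<open>l\<close>.\<close>
    have "((\<lambda>l. (1 - l) * integral\<^sup>L \<mu> q + l * K) \<longlongrightarrow> (1 - 0) * integral\<^sup>L \<mu> q + 0 * K) (at_right 0)"
      by (intro tendsto_intros)
    moreover have "eventually (\<lambda>l. (1 - l) * integral\<^sup>L \<mu> q + l * K \<le> integral\<^sup>L \<nu> F + ?C) (at_right (0::real))"
      using * by (auto simp: eventually_at_right_field intro!: exI[of _ 1])
    ultimately have "integral\<^sup>L \<mu> q \<le> integral\<^sup>L \<nu> F + ?C"
      using tendsto_upperbound[of _ _ "at_right (0::real)"] by fastforce
    moreover have "eint \<nu> \<phi> = ereal (integral\<^sup>L \<nu> F)"
      using F\<nu> by (rule eint_eq_integral)
    ultimately show ?thesis using cost(2) Qint by simp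
  qed
qed simp

text \<open>In this direction the potential is real-valued and of quadratic growth, so it is itself
  a test function for convex order once finite cost has put \<open>\<xi>\<close> into
  \<open>Pk 2\<close>. \<open>Q2bar \<phi>\<close> can be infinite, but it lies above
  \<open>\<phi>\<close>, and an infinite integral of it makes the dual value minus infinity.\<close>

lemma weak_duality_above:
  fixes \<mu> \<nu> :: "('a::euclidean_space) measure"
  assumes \<mu>: "\<mu> \<in> Pk 2" and \<nu>: "\<nu> \<in> Pk 2" and \<xi>: "\<xi> \<in> cx_above 1 \<mu>" and \<phi>: "\<phi> \<in> Acx \<inter> Sbk 2"
    and \<pi>: "\<pi> \<in> couplings \<xi> \<nu>"
  shows "eint \<mu> \<phi> - eint \<nu> (Q2bar \<phi>)
    \<le> enn2ereal (\<integral>\<^sup>+ p. ennreal ((norm (fst p - snd p))\<^sup>2) \<partial>\<pi>)"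
  using \<pi>
proof (cases rule: couplings_cost_cases)
  case 2
  note cost = 2
  define F where "F = (\<lambda>x. real_of_ereal (\<phi> x))"
  have F: "\<phi> x = ereal (F x)" for x
    using \<phi> by (auto simp: Sbk_def F_def ereal_real)
  have \<phi>F: "\<phi> = (\<lambda>x. ereal (F x))" using F by auto
  have Fm: "F \<in> borel_measurable borel" using \<phi> by (auto simp: Sbk_def F_def)
  obtain C where C: "\<And>x. \<bar>F x\<bar> \<le> C * (1 + (norm x)\<^sup>2)"
    using \<phi> by (auto simp: Sbk_def F_def)
  have conv: "convex_on UNIV F"
    using convex_on_of_Acx[of \<phi>] \<phi> by (auto simp: \<phi>F)
  have \<xi>1: "\<xi> \<in> Pk 1" and cx: "le_cx \<mu> \<xi>" using \<xi> by (auto simp: cx_above_def)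
  have \<xi>2: "\<xi> \<in> Pk 2"
    using couplings_second_moment[OF \<pi> cost(1)] PkD[OF \<nu>] PkD[OF \<xi>1] by (simp add: Pk_def)
  have Fi: "integrable M F" if "M \<in> Pk 2" for M
    using that Fm C by (rule integrable_quadratic_growth)
  have QF: "ereal (F x - (norm (x - y))\<^sup>2) \<le> Q2bar \<phi> y" for x y
    unfolding Q2bar_def by (intro SUP_upper2[of x]) (auto simp: F)
  have Qge: "ereal (F y) \<le> Q2bar \<phi> y" for y using QF[of y y] by simp
  have Qm: "Q2bar \<phi> \<in> borel_measurable \<nu>"
    using Q2bar_measurable[of \<phi>] PkD(2)[OF \<nu>] by (simp cong: measurable_cong_sets)
  have F\<mu>: "eint \<mu> \<phi> = ereal (integral\<^sup>L \<mu> F)"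
    using Fi[OF \<mu>] by (intro eint_eq_integral) (auto simp: F)
  show ?thesis
    using Qm Fi[OF \<nu>] Qge
  proof (cases rule: eint_infinite_or_integrable)
    case 1
    then show ?thesis by (simp add: F\<mu>)
  next
    case 2
    define q where "q = (\<lambda>x. real_of_ereal (Q2bar \<phi> x))"
    have q\<nu>: "integrable \<nu> q" "AE x in \<nu>. Q2bar \<phi> x = ereal (q x)"
      using 2 by (simp_all add: q_def)
    have qm: "q \<in> borel_measurable borel"
      unfolding q_def by (intro borel_measurable_real_of_ereal Q2bar_measurable)
    have q\<pi>: "integrable \<pi> (\<lambda>p. q (snd p))" using couplings_integral(2)[OF \<pi> qm] q\<nu>(1) by simp
    have "AE p in \<pi>. Q2bar \<phi> (snd p) = ereal (q (snd p))"
    proof -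
      have d: "distr \<pi> borel snd = \<nu>" using \<pi> by (simp add: couplings_def)
      have "AE x in distr \<pi> borel snd. Q2bar \<phi> x = ereal (q x)"
        unfolding d by (rule q\<nu>(2))
      then show ?thesis by (rule AE_distrD[OF couplings_measurable(2)[OF \<pi>]])
    qed
    then have ae: "AE p in \<pi>. F (fst p) \<le> q (snd p) + (norm (fst p - snd p))\<^sup>2"
    proof eventually_elim
      case (elim p)
      then show ?case using QF[of "fst p" "snd p"] by simp
    qed
    have "integral\<^sup>L \<mu> F \<le> integral\<^sup>L \<xi> F"
      by (rule le_cx_integral[OF cx conv Fi[OF \<mu>] Fi[OF \<xi>2]])
    also have "\<dots> = (\<integral>p. F (fst p) \<partial>\<pi>)" by (rule couplings_integral(3)[OF \<pi> Fm])
    also have "\<dots> \<le> (\<integral>p. q (snd p) + (norm (fst p - snd p))\<^sup>2 \<partial>\<pi>)"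
      using couplings_integral(1)[OF \<pi> Fm] Fi[OF \<xi>2] q\<pi> cost(1) ae by (intro integral_mono_AE) auto
    also have "\<dots> = integral\<^sup>L \<nu> q + (\<integral>p. (norm (fst p - snd p))\<^sup>2 \<partial>\<pi>)"
      using q\<pi> cost(1) couplings_integral(4)[OF \<pi> qm] by simp
    finally show ?thesis
      using eint_eq_integral[OF q\<nu>] F\<mu> cost(2) by simp
  qed
qed simp

section \<open>Maxima of affine functions and splittings\<close>

text \<open>
A near-minimiser is enough for an approximate first-order condition, so neither closedness of the
set of splittings nor a separation theorem is needed.
\<close>

lemma near_minimizer_variational:
  fixes q :: "'s \<Rightarrow> 'i \<Rightarrow> real" and u :: "'s \<Rightarrow> 'i \<Rightarrow> 'a::real_inner"
  assumes I: "finite I" and m: "\<And>i. i \<in> I \<Longrightarrow> 0 < m i" and S: "S \<noteq> {}"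
    and R: "0 \<le> R" and \<delta>: "0 < \<delta>"
    and q: "\<And>f i. f \<in> S \<Longrightarrow> i \<in> I \<Longrightarrow> 0 \<le> q f i \<and> q f i \<le> 1"
    and u: "\<And>f i. f \<in> S \<Longrightarrow> i \<in> I \<Longrightarrow> norm (u f i) \<le> B"
    and conv: "\<And>f g t. f \<in> S \<Longrightarrow> g \<in> S \<Longrightarrow> 0 \<le> t \<Longrightarrow> t \<le> 1 \<Longrightarrow> \<exists>h\<in>S. \<forall>i\<in>I.
      q h i = q f i + t * (q g i - q f i) \<and> u h i = u f i + t *\<^sub>R (u g i - u f i)"
  obtains f where "f \<in> S"
    and "\<And>g. g \<in> S \<Longrightarrow> (\<Sum>i\<in>I. (2 *\<^sub>R (x i - u f i /\<^sub>R m i)) \<bullet> (u g i - u f i)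
          + 2 * R * (m i - q f i) * (q g i - q f i)) \<le> \<delta>"
proof -
  \<comment> \<open>The cost of moving to barycentres, with the mass constraints replaced by a
    quadratic penalty.\<close>
  define \<Phi> where "\<Phi> f = (\<Sum>i\<in>I. m i * (norm (x i - u f i /\<^sub>R m i))\<^sup>2 + R * (q f i - m i)\<^sup>2)" for f
  \<comment> \<open>An upper bound for the second-order coefficient of \<open>\<Phi>\<close> along
    segments in \<open>S\<close>. The step \<open>t\<close> is then so short that the second-order
    term and the slack \<open>t * \<delta> / 2\<close> of the near-minimiser add up to at most
    \<open>t * \<delta>\<close>.\<close>
  define C where "C = (\<Sum>i\<in>I. (2 * B)\<^sup>2 / m i + R)"
  have C: "C \<ge> 0" unfolding C_def
    using m R by (intro sum_nonneg add_nonneg_nonneg divide_nonneg_nonneg) (auto intro: less_imp_le)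
  define t where "t = min 1 (\<delta> / (2 * (C + 1)))"
  have t: "0 < t" "t \<le> 1" using \<delta> C by (auto simp: t_def)
  have "t * C \<le> \<delta> / (2 * (C + 1)) * C" using C by (intro mult_right_mono) (auto simp: t_def)
  also have "\<dots> \<le> \<delta> / 2" using C \<delta> by (simp add: field_simps)
  finally have tC: "t * C \<le> \<delta> / 2" .
  have \<Phi>0: "0 \<le> \<Phi> f" for f
    unfolding \<Phi>_def using m R
    by (intro sum_nonneg add_nonneg_nonneg mult_nonneg_nonneg) (auto intro: less_imp_le)
  then have bdd: "bdd_below (\<Phi> ` S)" by (intro bdd_belowI2)
  have "Inf (\<Phi> ` S) < Inf (\<Phi> ` S) + t * \<delta> / 2" using t \<delta> by simp
  then obtain f where f: "f \<in> S" "\<Phi> f < Inf (\<Phi> ` S) + t * \<delta> / 2"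
    using S bdd by (metis (no_types, lifting) cINF_less_iff)
  show ?thesis
  proof (rule that[OF f(1)])
    fix g assume g: "g \<in> S"
    let ?L = "\<lambda>i. (2 *\<^sub>R (x i - u f i /\<^sub>R m i)) \<bullet> (u g i - u f i) + 2 * R * (m i - q f i) * (q g i - q f i)"
    let ?Q = "\<lambda>i. (norm (u g i - u f i))\<^sup>2 / m i + R * (q g i - q f i)\<^sup>2"
    obtain h where h: "h \<in> S" "\<And>i. i \<in> I \<Longrightarrow> q h i = q f i + t * (q g i - q f i)"
      "\<And>i. i \<in> I \<Longrightarrow> u h i = u f i + t *\<^sub>R (u g i - u f i)"
      using conv[OF f(1) g, of t] t by auto
    \<comment> \<open>The expansion is exact because \<open>\<Phi>\<close> is quadratic;
      \<open>?L\<close> is minus its directional derivative.\<close>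
    have exp: "m i * (norm (x i - u h i /\<^sub>R m i))\<^sup>2 + R * (q h i - m i)\<^sup>2
        = (m i * (norm (x i - u f i /\<^sub>R m i))\<^sup>2 + R * (q f i - m i)\<^sup>2) - t * ?L i + t\<^sup>2 * ?Q i"
      if i: "i \<in> I" for i
    proof -
      define p w where "p = x i - u f i /\<^sub>R m i" and "w = u g i - u f i"
      have "x i - u h i /\<^sub>R m i = p - (t / m i) *\<^sub>R w"
        unfolding h(3)[OF i] p_def w_def by (simp add: algebra_simps divide_inverse_commute)
      then have "(norm (x i - u h i /\<^sub>R m i))\<^sup>2 = (norm p)\<^sup>2 - 2 * (t / m i) * (p \<bullet> w) + (t / m i)\<^sup>2 * (norm w)\<^sup>2"
        unfolding power2_norm_eq_inner
        by (simp add: inner_diff_left inner_diff_right inner_commute power2_eq_square)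
      then have "m i * (norm (x i - u h i /\<^sub>R m i))\<^sup>2 = m i * (norm p)\<^sup>2 - t * (2 * (p \<bullet> w)) + t\<^sup>2 * ((norm w)\<^sup>2 / m i)"
        using m[OF i] by (simp add: field_simps power2_eq_square)
      moreover have "R * (q h i - m i)\<^sup>2 = R * (q f i - m i)\<^sup>2 - t * (2 * R * (m i - q f i) * (q g i - q f i)) + t\<^sup>2 * (R * (q g i - q f i)\<^sup>2)"
        unfolding h(2)[OF i] by (simp add: algebra_simps power2_eq_square)
      ultimately show ?thesis by (simp add: p_def w_def algebra_simps)
    qed
    have \<Phi>h: "\<Phi> h = \<Phi> f - t * sum ?L I + t\<^sup>2 * sum ?Q I"
      unfolding \<Phi>_def sum_distrib_left sum.distrib[symmetric] sum_subtractf[symmetric]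
      by (intro sum.cong refl exp)
    have "sum ?Q I \<le> C" unfolding C_def
    proof (intro sum_mono add_mono)
      fix i assume i: "i \<in> I"
      have "norm (u g i - u f i) \<le> 2 * B"
        using norm_triangle_ineq4[of "u g i" "u f i"] u[OF f(1) i] u[OF g i] by simp
      then show "(norm (u g i - u f i))\<^sup>2 / m i \<le> (2 * B)\<^sup>2 / m i"
        using m[OF i] by (intro divide_right_mono power_mono) auto
      have "\<bar>q g i - q f i\<bar> \<le> 1" using q[OF f(1) i] q[OF g i] by auto
      then have "(q g i - q f i)\<^sup>2 \<le> 1" by (simp add: abs_square_le_1)
      then show "R * (q g i - q f i)\<^sup>2 \<le> R" using R by (simp add: mult_left_le)
    qed
    then have "t\<^sup>2 * sum ?Q I \<le> t * (\<delta> / 2)"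
    proof -
      assume "sum ?Q I \<le> C"
      then have "t\<^sup>2 * sum ?Q I \<le> t * (t * C)"
        using t by (simp add: power2_eq_square mult_left_mono mult.assoc)
      also have "\<dots> \<le> t * (\<delta> / 2)" using tC t by (intro mult_left_mono) auto
      finally show ?thesis .
    qed
    moreover have "Inf (\<Phi> ` S) \<le> \<Phi> h" using h(1) bdd by (intro cINF_lower)
    ultimately have "t * sum ?L I \<le> t * \<delta>" using f(2) \<Phi>h by (simp add: algebra_simps)
    then show "sum ?L I \<le> \<delta>" using t by simp
  qed
qed

section \<open>Maxima of finitely many affine functions\<close>

definition max_affine :: "'i set \<Rightarrow> ('i \<Rightarrow> 'a) \<Rightarrow> ('i \<Rightarrow> real) \<Rightarrow> 'a::real_inner \<Rightarrow> real" where
  "max_affine I a b x = Max ((\<lambda>i. a i \<bullet> x + b i) ` I)"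

lemma max_affine_ge: "finite I \<Longrightarrow> i \<in> I \<Longrightarrow> a i \<bullet> x + b i \<le> max_affine I a b x"
  unfolding max_affine_def by (intro Max_ge) auto

lemma max_affine_attained:
  assumes "finite I" "I \<noteq> {}"
  obtains i where "i \<in> I" "max_affine I a b x = a i \<bullet> x + b i"
proof -
  have "max_affine I a b x \<in> (\<lambda>i. a i \<bullet> x + b i) ` I"
    unfolding max_affine_def using assms by (intro Max_in) auto
  then show ?thesis using that by auto
qed

lemma max_affine_measurable:
  fixes a :: "'i \<Rightarrow> 'a::euclidean_space"
  assumes "finite I"
  shows "max_affine I a b \<in> borel_measurable borel"
  unfolding max_affine_def[abs_def] using assms by measurable

lemma max_affine_bound:
  fixes a :: "'i \<Rightarrow> 'a::real_inner"
  assumes "finite I" "I \<noteq> {}"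
  shows "\<bar>max_affine I a b x\<bar> \<le> (\<Sum>i\<in>I. norm (a i) + \<bar>b i\<bar>) * (1 + norm x)"
proof -
  obtain i where i: "i \<in> I" "max_affine I a b x = a i \<bullet> x + b i"
    using max_affine_attained[OF assms] .
  have "\<bar>a i \<bullet> x + b i\<bar> \<le> norm (a i) * norm x + \<bar>b i\<bar>"
    using Cauchy_Schwarz_ineq2[of "a i" x] by linarith
  also have "\<dots> \<le> (norm (a i) + \<bar>b i\<bar>) * (1 + norm x)"
    by (simp add: algebra_simps)
  also have "\<dots> \<le> (\<Sum>i\<in>I. norm (a i) + \<bar>b i\<bar>) * (1 + norm x)"
    using i(1) assms(1) by (intro mult_right_mono member_le_sum) auto
  finally show ?thesis by (simp add: i(2))
qed

lemma max_affine_integrable: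
  fixes a :: "'i \<Rightarrow> 'a::euclidean_space"
  assumes "finite I" "I \<noteq> {}" "M \<in> Pk 2"
  shows "integrable M (max_affine I a b)"
proof (rule Bochner_Integration.integrable_bound)
  interpret prob_space M using PkD(1)[OF assms(3)] .
  show "integrable M (\<lambda>x. (\<Sum>i\<in>I. norm (a i) + \<bar>b i\<bar>) * (1 + norm x))"
    using PkD(4)[of M 1] assms(3) Pk_mono by auto
  show "max_affine I a b \<in> borel_measurable M"
    using max_affine_measurable[OF assms(1), of a b] PkD(2)[OF assms(3)] by (simp cong: measurable_cong_sets)
  show "AE x in M. norm (max_affine I a b x) \<le> norm ((\<Sum>i\<in>I. norm (a i) + \<bar>b i\<bar>) * (1 + norm x))"
    unfolding real_norm_def using max_affine_bound[OF assms(1,2)]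
    by (intro AE_I2 order_trans[OF _ abs_ge_self])
qed

section \<open>Splittings of a measure into finitely many pieces\<close>

text \<open>A splitting is encoded by the densities of its pieces. Fractional values make the set
  convex, and the densities sum to 1 at every point, so the notion does not refer to a measure and
  applies to both \<open>\<mu>\<close> and \<open>\<nu>\<close>.\<close>

definition partition_densities :: "'i set \<Rightarrow> ('i \<Rightarrow> 'a::euclidean_space \<Rightarrow> real) set" where
  "partition_densities I = {f. (\<forall>i\<in>I. f i \<in> borel_measurable borel \<and> (\<forall>z. 0 \<le> f i z)) \<and> (\<forall>z. (\<Sum>i\<in>I. f i z) = 1)}"

lemma partition_densities_range:
  assumes "finite I" "f \<in> partition_densities I" "i \<in> I"
  shows "0 \<le> f i z" "f i z \<le> 1"
proof -
  show "0 \<le> f i z" using assms by (auto simp: partition_densities_def)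
  have "f i z \<le> (\<Sum>i\<in>I. f i z)"
    using assms by (intro member_le_sum) (auto simp: partition_densities_def)
  then show "f i z \<le> 1" using assms by (simp add: partition_densities_def)
qed

lemma partition_densities_integrable:
  fixes \<nu> :: "('a::euclidean_space) measure"
  assumes \<nu>: "\<nu> \<in> Pk 2" and f: "finite I" "f \<in> partition_densities I" "i \<in> I"
  shows "integrable \<nu> (f i)" "integrable \<nu> (\<lambda>z. f i z *\<^sub>R z)"
    "0 \<le> (\<integral>z. f i z \<partial>\<nu>)" "(\<integral>z. f i z \<partial>\<nu>) \<le> 1"
    "norm (\<integral>z. f i z *\<^sub>R z \<partial>\<nu>) \<le> (\<integral>z. norm z \<partial>\<nu>)"
proof -
  interpret prob_space \<nu> using PkD(1)[OF \<nu>] .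
  note r = partition_densities_range[OF f]
  have [measurable]: "f i \<in> borel_measurable \<nu>" "(\<lambda>z. z) \<in> borel_measurable \<nu>"
    using f measurable_ident_sets[OF PkD(2)[OF \<nu>]] PkD(2)[OF \<nu>]
    by (auto simp: partition_densities_def cong: measurable_cong_sets)
  have n: "integrable \<nu> (\<lambda>z. norm z)"
    using PkD(4)[of \<nu> 1] \<nu> Pk_mono by auto
  show i: "integrable \<nu> (f i)"
    using r by (intro integrable_const_bound[of _ 1]) auto
  show i': "integrable \<nu> (\<lambda>z. f i z *\<^sub>R z)"
    by (rule Bochner_Integration.integrable_bound[OF n]) (use r in \<open>auto intro!: mult_left_le_one_le\<close>)
  show "0 \<le> (\<integral>z. f i z \<partial>\<nu>)" using r by (intro integral_nonneg_AE) auto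
  have "(\<integral>z. f i z \<partial>\<nu>) \<le> (\<integral>z. 1 \<partial>\<nu>)" using r i by (intro integral_mono) auto
  then show "(\<integral>z. f i z \<partial>\<nu>) \<le> 1" by (simp add: prob_space)
  have "norm (\<integral>z. f i z *\<^sub>R z \<partial>\<nu>) \<le> (\<integral>z. norm (f i z *\<^sub>R z) \<partial>\<nu>)" by (rule integral_norm_bound)
  also have "\<dots> \<le> (\<integral>z. norm z \<partial>\<nu>)"
    using n integrable_norm[OF i'] r by (intro integral_mono) (auto intro!: mult_left_le_one_le)
  finally show "norm (\<integral>z. f i z *\<^sub>R z \<partial>\<nu>) \<le> (\<integral>z. norm z \<partial>\<nu>)" .
qed

text \<open>Giving each \<open>z\<close> to the indices that attain the maximum there turns the
  integral of the maximum into a linear expression in the masses and first moments of a splitting.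
  This splitting is the competitor in the first-order condition.\<close>

lemma partition_densities_selector:
  fixes \<nu> :: "('a::euclidean_space) measure"
  assumes I: "finite I" "I \<noteq> {}" and \<nu>: "\<nu> \<in> Pk 2"
  obtains s where "s \<in> partition_densities I"
    and "(\<integral>z. max_affine I a b z \<partial>\<nu>)
      = (\<Sum>i\<in>I. a i \<bullet> (\<integral>z. s i z *\<^sub>R z \<partial>\<nu>) + b i * (\<integral>z. s i z \<partial>\<nu>))"
proof -
  \<comment> \<open>Ties are shared equally, which avoids a measurable choice of the maximising index.\<close>
  define e where "e i z = (if a i \<bullet> z + b i = max_affine I a b z then 1 else 0 :: real)" for i z
  define N where "N z = (\<Sum>i\<in>I. e i z)" for z
  define s where "s i z = e i z / N z" for i z
  have N: "N z > 0" for z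
  proof -
    obtain i where i: "i \<in> I" "max_affine I a b z = a i \<bullet> z + b i"
      using max_affine_attained[OF I] .
    then have "e i z = 1" by (simp add: e_def)
    moreover have "e i z \<le> N z"
      unfolding N_def using I i(1) by (intro member_le_sum) (auto simp: e_def)
    ultimately show ?thesis by simp
  qed
  have [measurable]: "max_affine I a b \<in> borel_measurable borel"
    by (rule max_affine_measurable[OF I(1)])
  have [measurable]: "e i \<in> borel_measurable borel" for i
    unfolding e_def[abs_def] by measurable
  have [measurable]: "N \<in> borel_measurable borel"
    unfolding N_def[abs_def] by measurable
  have s: "s \<in> partition_densities I"
    unfolding partition_densities_def
  proof (clarsimp, intro conjI ballI allI)
    fix i show "s i \<in> borel_measurable borel" unfolding s_def[abs_def] by measurable
    fix z show "0 \<le> s i z" using N[of z] by (simp add: s_def e_def)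
  next
    fix z show "(\<Sum>i\<in>I. s i z) = 1"
      using N[of z] unfolding s_def sum_divide_distrib[symmetric] N_def[symmetric] by simp
  qed
  have "max_affine I a b z = (\<Sum>i\<in>I. a i \<bullet> (s i z *\<^sub>R z) + b i * s i z)" for z
  proof -
    have "(\<Sum>i\<in>I. a i \<bullet> (s i z *\<^sub>R z) + b i * s i z) = (\<Sum>i\<in>I. s i z * max_affine I a b z)"
      by (intro sum.cong refl) (auto simp: s_def e_def algebra_simps add_divide_distrib[symmetric])
    also have "\<dots> = max_affine I a b z"
      using s by (simp add: sum_distrib_right[symmetric] partition_densities_def)
    finally show ?thesis by simp
  qed
  then have "(\<integral>z. max_affine I a b z \<partial>\<nu>) = (\<integral>z. (\<Sum>i\<in>I. a i \<bullet> (s i z *\<^sub>R z) + b i * s i z) \<partial>\<nu>)"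
    by simp
  also have "\<dots> = (\<Sum>i\<in>I. (\<integral>z. a i \<bullet> (s i z *\<^sub>R z) + b i * s i z \<partial>\<nu>))"
    by (intro Bochner_Integration.integral_sum Bochner_Integration.integrable_add
        integrable_inner_right integrable_mult_right partition_densities_integrable[OF \<nu> I(1) s])
  also have "\<dots> = (\<Sum>i\<in>I. a i \<bullet> (\<integral>z. s i z *\<^sub>R z \<partial>\<nu>) + b i * (\<integral>z. s i z \<partial>\<nu>))"
  proof (intro sum.cong refl)
    fix i assume i: "i \<in> I"
    note p = partition_densities_integrable(1,2)[OF \<nu> I(1) s i]
    show "(\<integral>z. a i \<bullet> (s i z *\<^sub>R z) + b i * s i z \<partial>\<nu>) = a i \<bullet> (\<integral>z. s i z *\<^sub>R z \<partial>\<nu>) + b i * (\<integral>z. s i z \<partial>\<nu>)"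
      by (subst Bochner_Integration.integral_add[OF integrable_inner_right integrable_mult_right])
        (use p in \<open>simp_all only: integral_inner_right integral_mult_right_zero\<close>)
  qed
  finally show ?thesis using s that by blast
qed

text \<open>\<open>H\<close> is the dual bound for a source with masses \<open>m i\<close> at the
  points \<open>x i\<close>. The mass constraints are at first only penalised; the near-minimiser
  then has masses with relative error at most \<open>\<tau>\<close>, and mixing in constants repairs
  them at a cost of order \<open>\<tau>\<close>.\<close>

lemma barycentric_splitting:
  fixes \<nu> :: "('a::euclidean_space) measure" and x :: "'i \<Rightarrow> 'a"
  assumes \<nu>: "\<nu> \<in> Pk 2" and I: "finite I" "I \<noteq> {}"
    and m: "\<And>i. i \<in> I \<Longrightarrow> 0 < m i" and m1: "(\<Sum>i\<in>I. m i) = 1"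
    and H: "\<And>a b. (\<Sum>i\<in>I. m i * (a i \<bullet> x i + b i - (norm (a i))\<^sup>2 / 4)) - (\<integral>z. max_affine I a b z \<partial>\<nu>) \<le> D"
    and \<epsilon>: "0 < \<epsilon>"
  obtains f where "f \<in> partition_densities I" and "\<And>i. i \<in> I \<Longrightarrow> (\<integral>z. f i z \<partial>\<nu>) = m i"
    and "(\<Sum>i\<in>I. m i * (norm (x i - (\<integral>z. f i z *\<^sub>R z \<partial>\<nu>) /\<^sub>R m i))\<^sup>2) \<le> D + \<epsilon>"
proof -
  interpret prob_space \<nu> using PkD(1)[OF \<nu>] .
  define q where "q f i = (\<integral>z. f i z \<partial>\<nu>)" for f :: "'i \<Rightarrow> 'a \<Rightarrow> real" and i
  define u where "u f i = (\<integral>z. f i z *\<^sub>R z \<partial>\<nu>)" for f :: "'i \<Rightarrow> 'a \<Rightarrow> real" and i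
  note int = partition_densities_integrable[OF \<nu> I(1)]
  have idint: "integrable \<nu> (\<lambda>z. z)"
    using integrable_power1_of_power2(1)[OF PkD(1,2)[OF \<nu>]] PkD(4)[OF \<nu>] by simp
  have D: "D \<ge> 0"
  proof -
    have "max_affine I (\<lambda>_. 0) (\<lambda>_. 0) z = 0" for z :: 'a
      using max_affine_attained[OF I, of "\<lambda>_. 0" "\<lambda>_. 0" z] by auto
    then show ?thesis using H[of "\<lambda>_. 0" "\<lambda>_. 0"] by simp
  qed
  define zb where "zb = (\<integral>z. z \<partial>\<nu>)"
  \<comment> \<open>\<open>C\<close> controls the cost of the repair, which moves a share
    \<open>\<tau>\<close> of each piece to a multiple of \<open>zb\<close> with factor at most
    2.\<close>
  define C where "C = (\<Sum>i\<in>I. m i * (norm (x i) + 2 * norm zb)\<^sup>2)"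
  have C: "C \<ge> 0" unfolding C_def using m by (intro sum_nonneg mult_nonneg_nonneg) (auto intro: less_imp_le)
  define \<tau> where "\<tau> = min (1/2) (\<epsilon> / (2 * (C + 1)))"
  have \<tau>: "0 < \<tau>" "\<tau> \<le> 1/2"
    unfolding \<tau>_def using \<epsilon> C by (simp_all only: min.cobounded1) simp
  have "\<tau> * C \<le> \<epsilon> / (2 * (C + 1)) * C" using C by (intro mult_right_mono) (auto simp: \<tau>_def)
  also have "\<dots> \<le> \<epsilon> / 2" using C \<epsilon> by (simp add: field_simps)
  finally have \<tau>C: "\<tau> * C \<le> \<epsilon> / 2" .
  define mm where "mm = Min (m ` I)"
  have mm: "0 < mm" "\<And>i. i \<in> I \<Longrightarrow> mm \<le> m i" using I m by (auto simp: mm_def)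
  \<comment> \<open>Chosen so that a penalty of at most \<open>D + \<epsilon>\<close> forces every
    mass error to be at most \<open>\<tau> * mm\<close>, hence at most
    \<open>\<tau> * m i\<close>.\<close>
  define R where "R = (D + \<epsilon>) / (\<tau> * mm)\<^sup>2"
  have R: "0 < R" using D \<epsilon> \<tau> mm by (auto simp: R_def)
  have conv: "\<exists>h\<in>partition_densities I. \<forall>i\<in>I. q h i = q f i + t * (q g i - q f i) \<and> u h i = u f i + t *\<^sub>R (u g i - u f i)"
    if f: "f \<in> partition_densities I" and g: "g \<in> partition_densities I" and t: "0 \<le> t" "t \<le> 1" for f g t
  proof (intro bexI ballI conjI)
    let ?h = "\<lambda>i z. (1 - t) * f i z + t * g i z"
    show "?h \<in> partition_densities I"
      using f g t by (auto simp: partition_densities_def sum.distrib sum_distrib_left[symmetric]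
          intro!: borel_measurable_add borel_measurable_times)
    fix i assume i: "i \<in> I"
    note p = int[OF f i] int[OF g i]
    show "q ?h i = q f i + t * (q g i - q f i)"
      using p by (simp add: q_def algebra_simps)
    have "u ?h i = (\<integral>z. (1 - t) *\<^sub>R (f i z *\<^sub>R z) + t *\<^sub>R (g i z *\<^sub>R z) \<partial>\<nu>)"
      by (simp add: u_def scaleR_add_left)
    also have "\<dots> = (1 - t) *\<^sub>R u f i + t *\<^sub>R u g i"
      unfolding u_def
      by (subst Bochner_Integration.integral_add[OF integrable_scaleR_right integrable_scaleR_right])
        (use p in \<open>simp_all only: integral_scaleR_right\<close>)
    finally show "u ?h i = u f i + t *\<^sub>R (u g i - u f i)" by (simp add: algebra_simps)
  qed
  have ne: "partition_densities I \<noteq> ({} :: ('i \<Rightarrow> 'a \<Rightarrow> real) set)"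
    using partition_densities_selector[OF I \<nu>] by blast
  obtain f where f: "f \<in> partition_densities I" and opt: "\<And>g. g \<in> partition_densities I \<Longrightarrow>
      (\<Sum>i\<in>I. (2 *\<^sub>R (x i - u f i /\<^sub>R m i)) \<bullet> (u g i - u f i) + 2 * R * (m i - q f i) * (q g i - q f i)) \<le> \<epsilon> / 2"
  proof (rule near_minimizer_variational[of I m "partition_densities I" R "\<epsilon> / 2" q u "\<integral>z. norm z \<partial>\<nu>" x])
    show "\<And>f i. f \<in> partition_densities I \<Longrightarrow> i \<in> I \<Longrightarrow> 0 \<le> q f i \<and> q f i \<le> 1"
      unfolding q_def using int(3,4) by blast
    show "\<And>f i. f \<in> partition_densities I \<Longrightarrow> i \<in> I \<Longrightarrow> norm (u f i) \<le> (\<integral>z. norm z \<partial>\<nu>)"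
      unfolding u_def using int(5) by blast
  qed (use I m ne R \<epsilon> conv in auto)
  \<comment> \<open>\<open>a\<close> and \<open>b\<close> are the negative partial derivatives of
    the penalised functional in \<open>u\<close> and in \<open>q\<close>; they become slopes and
    intercepts in \<open>H\<close>.\<close>
  define p where "p i = x i - u f i /\<^sub>R m i" for i
  define a where "a i = 2 *\<^sub>R p i" for i
  define b where "b i = 2 * R * (m i - q f i)" for i
  obtain s where s: "s \<in> partition_densities I"
    and smax: "(\<integral>z. max_affine I a b z \<partial>\<nu>) = (\<Sum>i\<in>I. a i \<bullet> u s i + b i * q s i)"
    using partition_densities_selector[OF I \<nu>, of a b] unfolding u_def q_def by blast
  have "(\<Sum>i\<in>I. a i \<bullet> u s i + b i * q s i) - (\<Sum>i\<in>I. a i \<bullet> u f i + b i * q f i) \<le> \<epsilon> / 2"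
  proof -
    have "(\<Sum>i\<in>I. a i \<bullet> u s i + b i * q s i) - (\<Sum>i\<in>I. a i \<bullet> u f i + b i * q f i)
        = (\<Sum>i\<in>I. a i \<bullet> (u s i - u f i) + b i * (q s i - q f i))"
      unfolding sum_subtractf[symmetric] inner_diff_right right_diff_distrib
      by (intro sum.cong refl) linarith
    then show ?thesis using opt[OF s] unfolding a_def b_def p_def by simp
  qed
  then have "(\<Sum>i\<in>I. m i * (a i \<bullet> x i + b i - (norm (a i))\<^sup>2 / 4)) - (\<Sum>i\<in>I. a i \<bullet> u f i + b i * q f i) \<le> D + \<epsilon> / 2"
    using H[of a b] smax by linarith
  \<comment> \<open>The product \<open>m i * (a i \<bullet> p i)\<close> is twice the transport term
    and the term with \<open>norm (a i)\<close> removes one copy; the \<open>b\<close> part is twice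
    the penalty.\<close>
  moreover have "(\<Sum>i\<in>I. m i * (a i \<bullet> x i + b i - (norm (a i))\<^sup>2 / 4)) - (\<Sum>i\<in>I. a i \<bullet> u f i + b i * q f i)
      = (\<Sum>i\<in>I. m i * (norm (p i))\<^sup>2 + 2 * R * (m i - q f i)\<^sup>2)"
    unfolding sum_subtractf[symmetric]
  proof (intro sum.cong refl)
    fix i assume i: "i \<in> I"
    have "m i * (a i \<bullet> x i) - a i \<bullet> u f i = m i * (a i \<bullet> p i)"
      using m[OF i] by (simp add: p_def inner_diff_right algebra_simps)
    moreover have "a i \<bullet> p i = 2 * (norm (p i))\<^sup>2" "(norm (a i))\<^sup>2 / 4 = (norm (p i))\<^sup>2"
      by (simp_all add: a_def power2_norm_eq_inner power_mult_distrib)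
    moreover have "b i * (m i - q f i) = 2 * R * (m i - q f i)\<^sup>2"
      by (simp add: b_def power2_eq_square)
    ultimately show "m i * (a i \<bullet> x i + b i - (norm (a i))\<^sup>2 / 4) - (a i \<bullet> u f i + b i * q f i)
        = m i * (norm (p i))\<^sup>2 + 2 * R * (m i - q f i)\<^sup>2"
      by (simp add: algebra_simps)
  qed
  ultimately have bound: "(\<Sum>i\<in>I. m i * (norm (p i))\<^sup>2 + 2 * R * (m i - q f i)\<^sup>2) \<le> D + \<epsilon> / 2"
    by simp
  have nn: "0 \<le> m i * (norm (p i))\<^sup>2" "0 \<le> 2 * R * (m i - q f i)\<^sup>2" if "i \<in> I" for i
    using m[OF that] R by auto
  have close: "\<bar>m i - q f i\<bar> \<le> \<tau> * m i" if i: "i \<in> I" for i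
  proof -
    have "m i * (norm (p i))\<^sup>2 + 2 * R * (m i - q f i)\<^sup>2
        \<le> (\<Sum>i\<in>I. m i * (norm (p i))\<^sup>2 + 2 * R * (m i - q f i)\<^sup>2)"
      using I(1) i nn by (intro member_le_sum[of i I "\<lambda>i. m i * (norm (p i))\<^sup>2 + 2 * R * (m i - q f i)\<^sup>2"]) auto
    then have "R * (m i - q f i)\<^sup>2 \<le> D + \<epsilon>" using bound nn[OF i] D \<epsilon> by linarith
    moreover have "(\<tau> * mm)\<^sup>2 > 0" using \<tau> mm by simp
    ultimately have "(D + \<epsilon>) * (m i - q f i)\<^sup>2 \<le> (D + \<epsilon>) * (\<tau> * mm)\<^sup>2"
      unfolding R_def times_divide_eq_left by (simp only: pos_divide_le_eq)
    then have "(m i - q f i)\<^sup>2 \<le> (\<tau> * mm)\<^sup>2"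
      by (rule mult_left_le_imp_le) (use D \<epsilon> in linarith)
    also have "\<dots> \<le> (\<tau> * m i)\<^sup>2"
      using \<tau> mm(1) mm(2)[OF i] by (intro power_mono mult_left_mono) auto
    finally have "\<bar>m i - q f i\<bar> \<le> \<bar>\<tau> * m i\<bar>" by (simp add: abs_le_square_iff)
    then show ?thesis using \<tau> m[OF i] by (simp add: abs_mult)
  qed
  \<comment> \<open>The mass still missing after scaling \<open>f\<close> by
    \<open>1 - \<tau>\<close>; the bound on the mass errors keeps it nonnegative.\<close>
  define c where "c i = m i - (1 - \<tau>) * q f i" for i
  have c: "0 \<le> c i" "c i \<le> 2 * \<tau> * m i" if i: "i \<in> I" for i
  proof -
    have "(1 - \<tau>) * q f i \<le> (1 - \<tau>) * ((1 + \<tau>) * m i)"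
      using close[OF i] \<tau> by (intro mult_left_mono) (auto simp: algebra_simps)
    also have "\<dots> = m i - \<tau> * \<tau> * m i" by (simp add: algebra_simps)
    also have "\<dots> \<le> m i" using m[OF i] by simp
    finally show "0 \<le> c i" by (simp add: c_def)
    have "c i = \<tau> * m i + (1 - \<tau>) * (m i - q f i)" by (simp add: c_def algebra_simps)
    also have "(1 - \<tau>) * (m i - q f i) \<le> (1 - \<tau>) * (\<tau> * m i)"
      using close[OF i] \<tau> by (intro mult_left_mono) auto
    also have "\<dots> \<le> \<tau> * m i" using \<tau> m[OF i] by (simp add: algebra_simps)
    finally show "c i \<le> 2 * \<tau> * m i" by simp
  qed
  \<comment> \<open>The correction by constants restores the exact masses without spoiling \<open>\<Sum>\<^sub>i f\<^sub>i = 1\<close>.\<close>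
  define f' where "f' = (\<lambda>i z. (1 - \<tau>) * f i z + c i)"
  have q1: "(\<Sum>i\<in>I. q f i) = 1"
  proof -
    have "(\<Sum>i\<in>I. q f i) = (\<integral>z. (\<Sum>i\<in>I. f i z) \<partial>\<nu>)"
      unfolding q_def by (rule Bochner_Integration.integral_sum[symmetric, OF int(1)[OF f]])
    then show ?thesis using f by (simp add: partition_densities_def prob_space)
  qed
  have f': "f' \<in> partition_densities I"
    using f \<tau> c(1) m1 q1
    by (auto simp: partition_densities_def f'_def c_def sum.distrib sum_distrib_left[symmetric] sum_subtractf
        intro!: borel_measurable_add borel_measurable_times)
  show ?thesis
  proof (rule that[OF f'])
    fix i assume i: "i \<in> I"
    show "(\<integral>z. f' i z \<partial>\<nu>) = m i"
      using int(1)[OF f i] by (simp add: f'_def c_def prob_space q_def)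
  next
    have "(\<Sum>i\<in>I. m i * (norm (x i - (\<integral>z. f' i z *\<^sub>R z \<partial>\<nu>) /\<^sub>R m i))\<^sup>2)
        \<le> (\<Sum>i\<in>I. (1 - \<tau>) * (m i * (norm (p i))\<^sup>2) + \<tau> * (m i * (norm (x i) + 2 * norm zb)\<^sup>2))"
    proof (rule sum_mono)
      fix i assume i: "i \<in> I"
      have "(\<integral>z. f' i z *\<^sub>R z \<partial>\<nu>) = (\<integral>z. (1 - \<tau>) *\<^sub>R (f i z *\<^sub>R z) + c i *\<^sub>R z \<partial>\<nu>)"
        by (simp add: f'_def scaleR_add_left)
      also have "\<dots> = (1 - \<tau>) *\<^sub>R u f i + c i *\<^sub>R zb"
        unfolding u_def zb_def
        by (subst Bochner_Integration.integral_add[OF integrable_scaleR_right integrable_scaleR_right])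
          (use int(2)[OF f i] idint in \<open>simp_all only: integral_scaleR_right\<close>)
      finally have u': "(\<integral>z. f' i z *\<^sub>R z \<partial>\<nu>) = (1 - \<tau>) *\<^sub>R u f i + c i *\<^sub>R zb" .
      \<comment> \<open>Normalised so that the new residual is the convex combination, with weight
        \<open>\<tau>\<close> on the second, of \<open>p i\<close> and
        \<open>x i - k *\<^sub>R zb\<close>; convexity of the squared norm then applies.\<close>
      define k where "k = c i / (\<tau> * m i)"
      have k: "0 \<le> k" "k \<le> 2" using c[OF i] \<tau> m[OF i] by (auto simp: k_def field_simps)
      have "c i / m i = \<tau> * k" using \<tau> by (simp add: k_def)
      then have eq: "x i - ((1 - \<tau>) *\<^sub>R u f i + c i *\<^sub>R zb) /\<^sub>R m i = (1 - \<tau>) *\<^sub>R p i + \<tau> *\<^sub>R (x i - k *\<^sub>R zb)"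
        by (simp add: p_def algebra_simps divide_inverse_commute)
      have "norm (x i - k *\<^sub>R zb) \<le> norm (x i) + k * norm zb"
        using norm_triangle_ineq4[of "x i" "k *\<^sub>R zb"] k by simp
      also have "\<dots> \<le> norm (x i) + 2 * norm zb" using k by (simp add: mult_right_mono)
      finally have "(norm (x i - k *\<^sub>R zb))\<^sup>2 \<le> (norm (x i) + 2 * norm zb)\<^sup>2" by (intro power_mono) auto
      then have "(norm ((1 - \<tau>) *\<^sub>R p i + \<tau> *\<^sub>R (x i - k *\<^sub>R zb)))\<^sup>2
          \<le> (1 - \<tau>) * (norm (p i))\<^sup>2 + \<tau> * (norm (x i) + 2 * norm zb)\<^sup>2"
        using \<tau> by (intro order_trans[OF norm_square_convex] add_left_mono mult_left_mono) auto
      then have "m i * (norm ((1 - \<tau>) *\<^sub>R p i + \<tau> *\<^sub>R (x i - k *\<^sub>R zb)))\<^sup>2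
          \<le> m i * ((1 - \<tau>) * (norm (p i))\<^sup>2 + \<tau> * (norm (x i) + 2 * norm zb)\<^sup>2)"
        using m[OF i] by (intro mult_left_mono) auto
      then show "m i * (norm (x i - (\<integral>z. f' i z *\<^sub>R z \<partial>\<nu>) /\<^sub>R m i))\<^sup>2
          \<le> (1 - \<tau>) * (m i * (norm (p i))\<^sup>2) + \<tau> * (m i * (norm (x i) + 2 * norm zb)\<^sup>2)"
        unfolding u' eq by (simp add: algebra_simps)
    qed
    also have "\<dots> = (1 - \<tau>) * (\<Sum>i\<in>I. m i * (norm (p i))\<^sup>2) + \<tau> * C"
      by (simp add: sum.distrib sum_distrib_left C_def)
    also have "(1 - \<tau>) * (\<Sum>i\<in>I. m i * (norm (p i))\<^sup>2) \<le> 1 * (\<Sum>i\<in>I. m i * (norm (p i))\<^sup>2)"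
      using \<tau> nn by (intro mult_right_mono sum_nonneg) auto
    also have "1 * (\<Sum>i\<in>I. m i * (norm (p i))\<^sup>2) \<le> (\<Sum>i\<in>I. m i * (norm (p i))\<^sup>2 + 2 * R * (m i - q f i)\<^sup>2)"
      unfolding mult_1 using R by (intro sum_mono) auto
    also note bound
    finally show "(\<Sum>i\<in>I. m i * (norm (x i - (\<integral>z. f' i z *\<^sub>R z \<partial>\<nu>) /\<^sub>R m i))\<^sup>2) \<le> D + \<epsilon>"
      using \<tau>C by linarith
  qed
qed

section \<open>The transport kernel\<close>

text \<open>Simple functions bounded by twice the norm converge to the identity in mean square by
  dominated convergence. Null fibres are redirected to a fibre of positive mass, so that cell masses
  can later be divided by.\<close>

lemma finite_valued_approximation:
  fixes \<mu> :: "('a::euclidean_space) measure"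
  assumes \<mu>: "\<mu> \<in> Pk 2" and \<epsilon>: "0 < \<epsilon>"
  obtains c where "c \<in> borel_measurable borel" and "finite (range c)"
    and "\<And>i. i \<in> range c \<Longrightarrow> 0 < measure \<mu> (c -` {i})" and "(\<integral>x. (norm (x - c x))\<^sup>2 \<partial>\<mu>) < \<epsilon>"
proof -
  interpret prob_space \<mu> using PkD(1)[OF \<mu>] .
  have sp: "space \<mu> = UNIV" by (rule PkD(3)[OF \<mu>])
  have [measurable]: "(\<lambda>x. x) \<in> borel_measurable \<mu>"
    using measurable_ident_sets[OF PkD(2)[OF \<mu>]] by simp
  obtain F where F: "\<And>n. simple_function \<mu> (F n)" "\<And>x. (\<lambda>n. F n x) \<longlonglongrightarrow> x"
    "\<And>n x. dist (F n x) 0 \<le> 2 * dist x 0"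
    using borel_measurable_implies_sequence_metric[of "\<lambda>x. x" \<mu> 0] sp by auto
  note [measurable] = borel_measurable_simple_function[OF F(1)]
  have "(\<lambda>n. \<integral>x. (norm (x - F n x))\<^sup>2 \<partial>\<mu>) \<longlonglongrightarrow> (\<integral>x. 0 \<partial>\<mu>)"
  proof (rule integral_dominated_convergence[where w = "\<lambda>x. 9 * (norm x)\<^sup>2"])
    show "integrable \<mu> (\<lambda>x. 9 * (norm x)\<^sup>2)" using PkD(4)[OF \<mu>] by simp
    show "AE x in \<mu>. (\<lambda>n. (norm (x - F n x))\<^sup>2) \<longlonglongrightarrow> 0"
    proof (rule AE_I2)
      fix x
      have "(\<lambda>n. (norm (x - F n x))\<^sup>2) \<longlonglongrightarrow> (norm (x - x))\<^sup>2"
        by (intro tendsto_intros F(2))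
      then show "(\<lambda>n. (norm (x - F n x))\<^sup>2) \<longlonglongrightarrow> 0" by simp
    qed
    show "AE x in \<mu>. norm ((norm (x - F n x))\<^sup>2) \<le> 9 * (norm x)\<^sup>2" for n
    proof (rule AE_I2)
      fix x
      have "norm (x - F n x) \<le> 3 * norm x"
        using norm_triangle_ineq4[of x "F n x"] F(3)[of n x] by simp
      then have "(norm (x - F n x))\<^sup>2 \<le> (3 * norm x)\<^sup>2" by (intro power_mono) auto
      then show "norm ((norm (x - F n x))\<^sup>2) \<le> 9 * (norm x)\<^sup>2" by (simp add: power_mult_distrib)
    qed
  qed auto
  then have "eventually (\<lambda>n. (\<integral>x. (norm (x - F n x))\<^sup>2 \<partial>\<mu>) < \<epsilon>) sequentially"
    using \<epsilon> by (intro order_tendstoD(2)) auto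
  then obtain n where n: "(\<integral>x. (norm (x - F n x))\<^sup>2 \<partial>\<mu>) < \<epsilon>"
    by (auto simp: eventually_sequentially)
  define s where "s = F n"
  have fin: "finite (range s)" using F(1)[of n] sp by (simp add: simple_function_def s_def)
  have [measurable]: "s \<in> borel_measurable \<mu>" by (simp add: s_def)
  have ms[measurable]: "s -` {i} \<in> sets \<mu>" for i
    using measurable_sets[of s \<mu> borel "{i}"] sp by simp
  define J where "J = {i \<in> range s. 0 < measure \<mu> (s -` {i})}"
  have null: "measure \<mu> (\<Union>i\<in>range s - J. s -` {i}) = 0"
  proof -
    have "measure \<mu> (\<Union>i\<in>range s - J. s -` {i}) \<le> (\<Sum>i\<in>range s - J. measure \<mu> (s -` {i}))"
      using fin by (intro finite_measure_subadditive_finite) auto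
    also have "\<dots> \<le> 0"
      by (intro sum_nonpos) (auto simp: J_def not_less)
    finally show ?thesis using measure_nonneg[of \<mu>] by (simp add: antisym)
  qed
  have ae: "AE x in \<mu>. s x \<in> J"
  proof (rule AE_I)
    show "{x \<in> space \<mu>. s x \<notin> J} \<subseteq> (\<Union>i\<in>range s - J. s -` {i})" by auto
    show "(\<Union>i\<in>range s - J. s -` {i}) \<in> sets \<mu>" using fin by auto
    show "emeasure \<mu> (\<Union>i\<in>range s - J. s -` {i}) = 0"
      using null by (simp add: emeasure_eq_measure)
  qed
  have "J \<noteq> {}"
  proof
    assume "J = {}"
    then have "AE x in \<mu>. False" using ae by simp
    then show False by simp
  qed
  then obtain i0 where i0: "i0 \<in> J" by auto
  define c where "c x = (if s x \<in> J then s x else i0)" for x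
  have cm: "c \<in> borel_measurable \<mu>"
  proof -
    have "{x \<in> space \<mu>. s x \<in> J} \<in> sets \<mu>"
    proof -
      have "{x \<in> space \<mu>. s x \<in> J} = (\<Union>i\<in>J. s -` {i})" using sp by auto
      moreover have "finite J" using fin by (simp add: J_def)
      ultimately show ?thesis by auto
    qed
    then show ?thesis unfolding c_def[abs_def] by measurable
  qed
  have rc: "range c \<subseteq> J" using i0 by (auto simp: c_def)
  show ?thesis
  proof (rule that[of c])
    show "c \<in> borel_measurable borel" using cm by (simp add: Pk_measurable[OF \<mu>])
    have "J \<subseteq> range s" by (auto simp: J_def)
    with rc fin show "finite (range c)" by (meson finite_subset)
    fix i assume "i \<in> range c"
    then have i: "i \<in> J" using rc by auto
    have "s -` {i} \<subseteq> c -` {i}" using i by (auto simp: c_def)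
    moreover have "c -` {i} \<in> sets \<mu>" using measurable_sets[OF cm, of "{i}"] sp by simp
    ultimately have "measure \<mu> (s -` {i}) \<le> measure \<mu> (c -` {i})" by (rule finite_measure_mono)
    then show "0 < measure \<mu> (c -` {i})" using i by (simp add: J_def)
  next
    have "(\<integral>x. (norm (x - c x))\<^sup>2 \<partial>\<mu>) = (\<integral>x. (norm (x - s x))\<^sup>2 \<partial>\<mu>)"
    proof (rule integral_cong_AE)
      show "AE x in \<mu>. (norm (x - c x))\<^sup>2 = (norm (x - s x))\<^sup>2"
        using ae by eventually_elim (simp add: c_def)
    qed (use cm in measurable)
    then show "(\<integral>x. (norm (x - c x))\<^sup>2 \<partial>\<mu>) < \<epsilon>" using n by (simp add: s_def)
  qed
qed

text \<open>The kernel depends on \<open>x\<close> only through its cell \<open>c x\<close>: it is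
  the density of the piece of \<open>\<nu>\<close> given to that cell, divided by the cell mass, and
  \<open>Y\<close> is the barycentre of the piece. Cells are represented by their barycentres under
  \<open>\<mu>\<close> instead of the values of \<open>c\<close>, so that affine functions integrate
  exactly.\<close>

lemma transport_kernel:
  fixes \<mu> \<nu> :: "('a::euclidean_space) measure"
  assumes \<mu>: "\<mu> \<in> Pk 2" and \<nu>: "\<nu> \<in> Pk 2"
    and H: "\<And>(I::'a set) a b. finite I \<Longrightarrow> I \<noteq> {} \<Longrightarrow>
      (\<integral>x. max_affine I a (\<lambda>i. b i - (norm (a i))\<^sup>2 / 4) x \<partial>\<mu>) - (\<integral>z. max_affine I a b z \<partial>\<nu>) \<le> D"
    and \<epsilon>: "0 < \<epsilon>"
  obtains g :: "'a \<Rightarrow> 'a \<Rightarrow> real" and Y :: "'a \<Rightarrow> 'a"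
  where "(\<lambda>p. g (fst p) (snd p)) \<in> borel_measurable (borel \<Otimes>\<^sub>M borel)"
    and "\<And>x z. 0 \<le> g x z"
    and "Y \<in> borel_measurable borel" and "finite (range Y)"
    and "\<And>x. (\<integral>z. g x z \<partial>\<nu>) = 1" and "\<And>z. (\<integral>x. g x z \<partial>\<mu>) = 1"
    and "\<And>x. integrable \<nu> (\<lambda>z. g x z *\<^sub>R z)" and "\<And>x. (\<integral>z. g x z *\<^sub>R z \<partial>\<nu>) = Y x"
    and "(\<integral>x. (norm (x - Y x))\<^sup>2 \<partial>\<mu>) \<le> D + \<epsilon>"
proof -
  interpret prob_space \<mu> using PkD(1)[OF \<mu>] .
  obtain c where c[measurable]: "c \<in> borel_measurable borel" and fin: "finite (range c)"
    and pos: "\<And>i. i \<in> range c \<Longrightarrow> 0 < measure \<mu> (c -` {i})"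
    and capp: "(\<integral>x. (norm (x - c x))\<^sup>2 \<partial>\<mu>) < \<epsilon> / 2"
    using finite_valued_approximation[OF \<mu>, of "\<epsilon> / 2"] \<epsilon> by auto
  define I where "I = range c"
  have I: "finite I" "I \<noteq> {}" using fin by (auto simp: I_def)
  have cI: "c x \<in> I" for x by (simp add: I_def)
  \<comment> \<open>The cell indicators form a splitting of \<open>\<mu>\<close>, so the
    integrability facts for splittings apply to them too.\<close>
  define e where "e = (\<lambda>i x. indicator (c -` {i}) x :: real)"
  have e_sum: "(\<Sum>i\<in>I. e i x * F i) = F (c x)" for x and F :: "'a \<Rightarrow> real"
  proof -
    have "(\<Sum>i\<in>I. e i x * F i) = (\<Sum>i\<in>I. if i = c x then F i else 0)"
      by (intro sum.cong refl) (auto simp: e_def indicator_def)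
    then show ?thesis using I(1) cI by simp
  qed
  have cset: "c -` {i} \<in> sets borel" for i using measurable_sets[OF c, of "{i}"] by simp
  have e: "e \<in> partition_densities I"
    using e_sum[of _ "\<lambda>_. 1"] cset by (auto simp: partition_densities_def e_def)
  define m where "m i = measure \<mu> (c -` {i})" for i
  have m: "0 < m i" if "i \<in> I" for i using pos that by (simp add: m_def I_def)
  have em: "(\<integral>x. e i x \<partial>\<mu>) = m i" for i
    using cset[of i] by (simp add: e_def m_def PkD(2,3)[OF \<mu>])
  note eint' = partition_densities_integrable[OF \<mu> I(1) e]
  define xb where "xb i = (\<integral>x. e i x *\<^sub>R x \<partial>\<mu>) /\<^sub>R m i" for i
  have xb: "(\<integral>x. e i x *\<^sub>R x \<partial>\<mu>) = m i *\<^sub>R xb i" if "i \<in> I" for i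
    using m[OF that] by (simp add: xb_def)
  define S where "S i = (\<integral>x. e i x * (norm x)\<^sup>2 \<partial>\<mu>)" for i
  have eS: "integrable \<mu> (\<lambda>x. e i x * (norm x)\<^sup>2)" for i
  proof (rule Bochner_Integration.integrable_bound[OF PkD(4)[OF \<mu>]])
    show "(\<lambda>x. e i x * (norm x)\<^sup>2) \<in> borel_measurable \<mu>"
      unfolding Pk_measurable[OF \<mu>] e_def using cset[of i] by measurable
  qed (auto simp: e_def indicator_def)
  \<comment> \<open>One formula for a multiple of the squared norm plus a function affine on each
    cell; the cost, the total mass, the affine lower bound and the marginal of the kernel are
    instances of it.\<close>
  have cell: "(\<integral>x. k * (norm x)\<^sup>2 + (v (c x) \<bullet> x + w (c x)) \<partial>\<mu>)
      = (\<Sum>i\<in>I. k * S i + (m i * (v i \<bullet> xb i) + m i * w i))"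
    and celli: "integrable \<mu> (\<lambda>x. k * (norm x)\<^sup>2 + (v (c x) \<bullet> x + w (c x)))"
    for k :: real and v :: "'a \<Rightarrow> 'a" and w
  proof -
    have i: "integrable \<mu> (\<lambda>x. k * (e i x * (norm x)\<^sup>2) + (v i \<bullet> (e i x *\<^sub>R x) + w i * e i x))" if "i \<in> I" for i
      by (intro Bochner_Integration.integrable_add integrable_mult_right integrable_inner_right eS eint' that)
    have eq: "k * (norm x)\<^sup>2 + (v (c x) \<bullet> x + w (c x))
        = (\<Sum>i\<in>I. k * (e i x * (norm x)\<^sup>2) + (v i \<bullet> (e i x *\<^sub>R x) + w i * e i x))" for x
      using e_sum[of x "\<lambda>i. k * (norm x)\<^sup>2 + (v i \<bullet> x + w i)"] by (simp add: algebra_simps)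
    show "integrable \<mu> (\<lambda>x. k * (norm x)\<^sup>2 + (v (c x) \<bullet> x + w (c x)))"
      unfolding eq by (intro Bochner_Integration.integrable_sum i)
    have "(\<integral>x. k * (norm x)\<^sup>2 + (v (c x) \<bullet> x + w (c x)) \<partial>\<mu>)
        = (\<Sum>i\<in>I. (\<integral>x. k * (e i x * (norm x)\<^sup>2) + (v i \<bullet> (e i x *\<^sub>R x) + w i * e i x) \<partial>\<mu>))"
      unfolding eq by (intro Bochner_Integration.integral_sum i)
    also have "\<dots> = (\<Sum>i\<in>I. k * S i + (m i * (v i \<bullet> xb i) + m i * w i))"
    proof (intro sum.cong refl)
      fix i assume j: "i \<in> I"
      have "(\<integral>x. k * (e i x * (norm x)\<^sup>2) + (v i \<bullet> (e i x *\<^sub>R x) + w i * e i x) \<partial>\<mu>)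
          = k * S i + (v i \<bullet> (\<integral>x. e i x *\<^sub>R x \<partial>\<mu>) + w i * m i)"
        unfolding S_def em[symmetric]
        by (subst Bochner_Integration.integral_add,
            (intro Bochner_Integration.integrable_add integrable_mult_right integrable_inner_right eS eint' j)+,
            subst Bochner_Integration.integral_add,
            (intro integrable_mult_right integrable_inner_right eint' j)+)
          (simp only: integral_mult_right_zero integral_inner_right[OF eint'(2)[OF j]])
      then show "(\<integral>x. k * (e i x * (norm x)\<^sup>2) + (v i \<bullet> (e i x *\<^sub>R x) + w i * e i x) \<partial>\<mu>)
          = k * S i + (m i * (v i \<bullet> xb i) + m i * w i)"
        by (simp add: xb[OF j])
    qed
    finally show "(\<integral>x. k * (norm x)\<^sup>2 + (v (c x) \<bullet> x + w (c x)) \<partial>\<mu>)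
      = (\<Sum>i\<in>I. k * S i + (m i * (v i \<bullet> xb i) + m i * w i))" .
  qed
  \<comment> \<open>In each cell the squared distance to a fixed point splits into the squared
    distance from the cell barycentre and a variance independent of the point.\<close>
  have cost: "(\<integral>x. (norm (x - y (c x)))\<^sup>2 \<partial>\<mu>)
      = (\<Sum>i\<in>I. m i * (norm (xb i - y i))\<^sup>2) + (\<Sum>i\<in>I. S i - m i * (norm (xb i))\<^sup>2)" for y
  proof -
    have "(norm (x - y (c x)))\<^sup>2 = 1 * (norm x)\<^sup>2 + ((- 2 *\<^sub>R y (c x)) \<bullet> x + (norm (y (c x)))\<^sup>2)" for x
      by (simp add: power2_norm_eq_inner inner_diff_left inner_diff_right inner_commute)
    then have "(\<integral>x. (norm (x - y (c x)))\<^sup>2 \<partial>\<mu>)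
        = (\<Sum>i\<in>I. 1 * S i + (m i * ((- 2 *\<^sub>R y i) \<bullet> xb i) + m i * (norm (y i))\<^sup>2))"
      using cell[of 1 "\<lambda>i. - 2 *\<^sub>R y i" "\<lambda>i. (norm (y i))\<^sup>2"] by presburger
    also have "\<dots> = (\<Sum>i\<in>I. m i * (norm (xb i - y i))\<^sup>2 + (S i - m i * (norm (xb i))\<^sup>2))"
      by (intro sum.cong refl)
        (simp add: power2_norm_eq_inner inner_diff_left inner_diff_right inner_commute algebra_simps)
    finally show ?thesis by (simp only: sum.distrib)
  qed
  \<comment> \<open>Taking \<open>y i = i\<close> sends every \<open>x\<close> to
    \<open>c x\<close>, so the within-cell variance is at most the approximation error.\<close>
  have var: "(\<Sum>i\<in>I. S i - m i * (norm (xb i))\<^sup>2) \<le> \<epsilon> / 2"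
  proof -
    have "0 \<le> (\<Sum>i\<in>I. m i * (norm (xb i - i))\<^sup>2)"
      using m by (intro sum_nonneg mult_nonneg_nonneg) (auto intro: less_imp_le)
    then show ?thesis using cost[of "\<lambda>i. i"] capp by simp
  qed
  have m1: "(\<Sum>i\<in>I. m i) = 1"
    using cell[of 0 "\<lambda>_. 0" "\<lambda>_. 1"] by (simp add: prob_space)
  \<comment> \<open>On each cell the maximum dominates the affine function carrying that cell's
    index, whose integral over the cell is the cell mass times its value at the barycentre.\<close>
  have H': "(\<Sum>i\<in>I. m i * (a i \<bullet> xb i + b i - (norm (a i))\<^sup>2 / 4)) - (\<integral>z. max_affine I a b z \<partial>\<nu>) \<le> D" for a b
  proof -
    let ?b = "\<lambda>i. b i - (norm (a i))\<^sup>2 / 4"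
    have "(\<Sum>i\<in>I. m i * (a i \<bullet> xb i + b i - (norm (a i))\<^sup>2 / 4))
        = (\<integral>x. 0 * (norm x)\<^sup>2 + (a (c x) \<bullet> x + ?b (c x)) \<partial>\<mu>)"
      unfolding cell[of 0 a ?b] by (intro sum.cong refl) (simp add: algebra_simps)
    also have "\<dots> \<le> (\<integral>x. max_affine I a ?b x \<partial>\<mu>)"
    proof (rule integral_mono[OF celli max_affine_integrable[OF I \<mu>]])
      fix x show "0 * (norm x)\<^sup>2 + (a (c x) \<bullet> x + ?b (c x)) \<le> max_affine I a ?b x"
        using max_affine_ge[OF I(1) cI, of a x x ?b] by simp
    qed
    finally show ?thesis using H[OF I, of a b] by linarith
  qed
  obtain f where f: "f \<in> partition_densities I" and fm: "\<And>i. i \<in> I \<Longrightarrow> (\<integral>z. f i z \<partial>\<nu>) = m i"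
    and fc: "(\<Sum>i\<in>I. m i * (norm (xb i - (\<integral>z. f i z *\<^sub>R z \<partial>\<nu>) /\<^sub>R m i))\<^sup>2) \<le> D + \<epsilon> / 2"
    using barycentric_splitting[OF \<nu> I m m1 H', of "\<epsilon> / 2"] \<epsilon> by auto
  note fint = partition_densities_integrable[OF \<nu> I(1) f]
  define y where "y i = (\<integral>z. f i z *\<^sub>R z \<partial>\<nu>) /\<^sub>R m i" for i
  show ?thesis
  proof (rule that[of "\<lambda>x z. f (c x) z / m (c x)" "\<lambda>x. y (c x)"])
    have *: "f (c x) z / m (c x) = (\<Sum>i\<in>I. e i x * (f i z / m i))" for x z
      by (rule e_sum[symmetric])
    have [measurable]: "f i \<in> borel_measurable borel" if "i \<in> I" for i
      using f that by (auto simp: partition_densities_def)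
    have [measurable]: "e i \<in> borel_measurable borel" for i
      unfolding e_def using cset[of i] by measurable
    show "(\<lambda>p. f (c (fst p)) (snd p) / m (c (fst p))) \<in> borel_measurable (borel \<Otimes>\<^sub>M borel)"
      unfolding * by measurable
    show "0 \<le> f (c x) z / m (c x)" for x z
      using partition_densities_range(1)[OF I(1) f cI] m[OF cI] by (simp add: less_imp_le)
    show "(\<lambda>x. y (c x)) \<in> borel_measurable borel"
    proof -
      have "simple_function borel c"
        using fin c by (simp add: simple_function_borel_measurable)
      then have "simple_function borel (\<lambda>x. y (c x))" by (rule simple_function_compose1)
      then show ?thesis by (rule borel_measurable_simple_function)
    qed
    show "finite (range (\<lambda>x. y (c x)))"
      using finite_imageI[OF fin, of y] by (simp add: image_image)
    show "(\<integral>z. f (c x) z / m (c x) \<partial>\<nu>) = 1" for x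
      using fm[OF cI, of x] m[OF cI, of x] by simp
    show "(\<integral>x. f (c x) z / m (c x) \<partial>\<mu>) = 1" for z
    proof -
      have "(\<integral>x. f (c x) z / m (c x) \<partial>\<mu>) = (\<integral>x. 0 * (norm x)\<^sup>2 + (0 \<bullet> x + f (c x) z / m (c x)) \<partial>\<mu>)"
        by simp
      also have "\<dots> = (\<Sum>i\<in>I. 0 * S i + (m i * (0 \<bullet> xb i) + m i * (f i z / m i)))"
        by (rule cell)
      also have "\<dots> = (\<Sum>i\<in>I. f i z)"
      proof (intro sum.cong refl)
        fix i assume "i \<in> I"
        then have "m i \<noteq> 0" using m by force
        then show "0 * S i + (m i * (0 \<bullet> xb i) + m i * (f i z / m i)) = f i z" by simp
      qed
      finally show ?thesis using f by (simp add: partition_densities_def)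
    qed
    have **: "(f (c x) z / m (c x)) *\<^sub>R z = (1 / m (c x)) *\<^sub>R (f (c x) z *\<^sub>R z)" for x z
      by simp
    show "integrable \<nu> (\<lambda>z. (f (c x) z / m (c x)) *\<^sub>R z)" for x
      unfolding ** by (intro integrable_scaleR_right fint(2) cI)
    show "(\<integral>z. (f (c x) z / m (c x)) *\<^sub>R z \<partial>\<nu>) = y (c x)" for x
      unfolding ** integral_scaleR_right y_def by (simp add: divide_inverse)
    show "(\<integral>x. (norm (x - y (c x)))\<^sup>2 \<partial>\<mu>) \<le> D + \<epsilon>"
      using cost[of y] var fc unfolding y_def[symmetric] by linarith
  qed
qed

section \<open>Strong duality\<close>

text \<open>By Tonelli in either order, the inner integral of the density is 1, which leaves the
  indicator of a set in the remaining variable.\<close>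

lemma kernel_joint_law:
  fixes \<mu> \<nu> :: "('a::euclidean_space) measure"
  assumes \<mu>: "\<mu> \<in> Pk 2" and \<nu>: "\<nu> \<in> Pk 2"
    and gm: "(\<lambda>p. g (fst p) (snd p)) \<in> borel_measurable (borel \<Otimes>\<^sub>M borel)"
    and g0: "\<And>x z. 0 \<le> g x z"
    and g\<nu>: "\<And>x. (\<integral>z. g x z \<partial>\<nu>) = 1" and g\<mu>: "\<And>z. (\<integral>x. g x z \<partial>\<mu>) = 1"
    and P: "P = density (\<mu> \<Otimes>\<^sub>M \<nu>) (\<lambda>p. ennreal (g (fst p) (snd p)))"
  shows "sets P = sets (borel :: ('a \<times> 'a) measure)" "prob_space P"
    and "distr P borel fst = \<mu>" "distr P borel snd = \<nu>"
proof -
  interpret \<mu>: prob_space \<mu> using PkD(1)[OF \<mu>] .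
  interpret \<nu>: prob_space \<nu> using PkD(1)[OF \<nu>] .
  interpret pair_sigma_finite \<mu> \<nu> ..
  have s: "sets (\<mu> \<Otimes>\<^sub>M \<nu>) = sets (borel \<Otimes>\<^sub>M borel)"
    using PkD(2)[OF \<mu>] PkD(2)[OF \<nu>] by (rule sets_pair_measure_cong)
  have gm'[measurable]: "(\<lambda>p. g (fst p) (snd p)) \<in> borel_measurable (\<mu> \<Otimes>\<^sub>M \<nu>)"
    using gm by (simp only: measurable_cong_sets[OF s refl])
  show sP: "sets P = sets (borel :: ('a \<times> 'a) measure)"
    unfolding P sets_density s borel_prod ..
  have nn: "(\<integral>\<^sup>+z. ennreal (g x z) \<partial>\<nu>) = 1" "(\<integral>\<^sup>+x. ennreal (g x z) \<partial>\<mu>) = 1" for x z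
  proof -
    \<comment> \<open>An integral equal to 1 already implies integrability, since a non-integrable
      function has integral 0.\<close>
    have "integrable \<nu> (g x)" "integrable \<mu> (\<lambda>x. g x z)"
      using g\<nu>[of x] g\<mu>[of z] not_integrable_integral_eq by fastforce+
    then show "(\<integral>\<^sup>+z. ennreal (g x z) \<partial>\<nu>) = 1" "(\<integral>\<^sup>+x. ennreal (g x z) \<partial>\<mu>) = 1"
      using g0 g\<nu>[of x] g\<mu>[of z] by (simp_all add: nn_integral_eq_integral)
  qed
  have mf: "fst \<in> measurable P borel" "snd \<in> measurable P borel"
    unfolding measurable_cong_sets[OF sP refl] borel_prod[symmetric] by measurable
  have em: "emeasure P A = (\<integral>\<^sup>+p. ennreal (g (fst p) (snd p)) * indicator A p \<partial>(\<mu> \<Otimes>\<^sub>M \<nu>))"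
    if "A \<in> sets P" for A
    using that unfolding P by (simp add: emeasure_density)
  show d1: "distr P borel fst = \<mu>"
  proof (rule measure_eqI)
    fix A assume "A \<in> sets (distr P borel fst)"
    then have A: "A \<in> sets borel" by simp
    then have [measurable]: "A \<in> sets \<mu>" using PkD(2)[OF \<mu>] by simp
    have AP: "fst -` A \<inter> space P \<in> sets P" by (rule measurable_sets[OF mf(1) A])
    have "emeasure (distr P borel fst) A = emeasure P (fst -` A \<inter> space P)"
      by (rule emeasure_distr[OF mf(1) A])
    also have "\<dots> = (\<integral>\<^sup>+p. ennreal (g (fst p) (snd p)) * indicator A (fst p) \<partial>(\<mu> \<Otimes>\<^sub>M \<nu>))"
      unfolding em[OF AP] by (intro nn_integral_cong) (auto simp: P indicator_def)
    also have "\<dots> = (\<integral>\<^sup>+x. \<integral>\<^sup>+z. ennreal (g x z) * indicator A x \<partial>\<nu> \<partial>\<mu>)"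
      by (subst \<nu>.nn_integral_fst[symmetric]) auto
    also have "\<dots> = (\<integral>\<^sup>+x. indicator A x \<partial>\<mu>)"
    proof (rule nn_integral_cong)
      fix x assume x: "x \<in> space \<mu>"
      have "(\<lambda>z. ennreal (g x z)) \<in> borel_measurable \<nu>"
        using measurable_Pair2[OF gm' x] by simp
      then show "(\<integral>\<^sup>+z. ennreal (g x z) * indicator A x \<partial>\<nu>) = indicator A x"
        by (simp add: nn_integral_multc nn)
    qed
    finally show "emeasure (distr P borel fst) A = emeasure \<mu> A" by simp
  qed (simp add: PkD(2)[OF \<mu>])
  show "distr P borel snd = \<nu>"
  proof (rule measure_eqI)
    fix A assume "A \<in> sets (distr P borel snd)"
    then have A: "A \<in> sets borel" by simp
    then have [measurable]: "A \<in> sets \<nu>" using PkD(2)[OF \<nu>] by simp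
    have AP: "snd -` A \<inter> space P \<in> sets P" by (rule measurable_sets[OF mf(2) A])
    have "emeasure (distr P borel snd) A = emeasure P (snd -` A \<inter> space P)"
      by (rule emeasure_distr[OF mf(2) A])
    also have "\<dots> = (\<integral>\<^sup>+p. ennreal (g (fst p) (snd p)) * indicator A (snd p) \<partial>(\<mu> \<Otimes>\<^sub>M \<nu>))"
      unfolding em[OF AP] by (intro nn_integral_cong) (auto simp: P indicator_def)
    also have "\<dots> = (\<integral>\<^sup>+z. \<integral>\<^sup>+x. ennreal (g x z) * indicator A z \<partial>\<mu> \<partial>\<nu>)"
      by (subst nn_integral_snd[symmetric]) (auto simp: split_beta')
    also have "\<dots> = (\<integral>\<^sup>+z. indicator A z \<partial>\<nu>)"
    proof (rule nn_integral_cong)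
      fix z assume z: "z \<in> space \<nu>"
      have "(\<lambda>x. ennreal (g x z)) \<in> borel_measurable \<mu>"
        using measurable_Pair1[OF gm' z] by simp
      then show "(\<integral>\<^sup>+x. ennreal (g x z) * indicator A z \<partial>\<mu>) = indicator A z"
        by (simp add: nn_integral_multc nn)
    qed
    finally show "emeasure (distr P borel snd) A = emeasure \<nu> A" by simp
  qed (simp add: PkD(2)[OF \<nu>])
  show "prob_space P"
    using d1 \<mu>.prob_space_axioms by (auto intro: prob_space_distrD[OF mf(1)])
qed

text \<open>Given \<open>x\<close>, the variable \<open>h x + z - Y x\<close> has mean
  \<open>h x\<close> under the density \<open>g x\<close>, so this is conditional Jensen for a
  martingale step. A general \<open>h\<close> covers both uses: \<open>h = Y\<close> puts the law of
  \<open>Y\<close> below \<open>\<nu>\<close>, and the identity puts \<open>\<mu>\<close> below the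
  shifted law.\<close>

lemma le_cx_kernel:
  fixes \<mu> \<nu> :: "('a::euclidean_space) measure"
  assumes \<mu>: "\<mu> \<in> Pk 2" and \<nu>: "\<nu> \<in> Pk 2"
    and gm: "(\<lambda>p. g (fst p) (snd p)) \<in> borel_measurable (borel \<Otimes>\<^sub>M borel)"
    and g0: "\<And>x z. 0 \<le> g x z"
    and g\<nu>: "\<And>x. (\<integral>z. g x z \<partial>\<nu>) = 1"
    and gi: "\<And>x. integrable \<nu> (\<lambda>z. g x z *\<^sub>R z)" and gY: "\<And>x. (\<integral>z. g x z *\<^sub>R z \<partial>\<nu>) = Y x"
    and P: "P = density (\<mu> \<Otimes>\<^sub>M \<nu>) (\<lambda>p. ennreal (g (fst p) (snd p)))"
    and Y: "Y \<in> borel_measurable borel" and h: "h \<in> borel_measurable borel"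
    and P1: "distr \<mu> borel h \<in> Pk 1" "distr P borel (\<lambda>p. h (fst p) + snd p - Y (fst p)) \<in> Pk 1"
  shows "le_cx (distr \<mu> borel h) (distr P borel (\<lambda>p. h (fst p) + snd p - Y (fst p)))"
  unfolding le_cx_def
proof (intro allI impI)
  fix \<phi> :: "'a \<Rightarrow> real" assume conv: "convex_on UNIV \<phi>"
  interpret \<mu>: prob_space \<mu> using PkD(1)[OF \<mu>] .
  interpret \<nu>: prob_space \<nu> using PkD(1)[OF \<nu>] .
  interpret pair_sigma_finite \<mu> \<nu> ..
  have s: "sets (\<mu> \<Otimes>\<^sub>M \<nu>) = sets (borel \<Otimes>\<^sub>M borel)"
    using PkD(2)[OF \<mu>] PkD(2)[OF \<nu>] by (rule sets_pair_measure_cong)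
  note [measurable] = Y h gm
  have gm'[measurable]: "(\<lambda>p. g (fst p) (snd p)) \<in> borel_measurable (\<mu> \<Otimes>\<^sub>M \<nu>)"
    using gm by (simp only: measurable_cong_sets[OF s refl])
  define W where "W p = h (fst p) + snd p - Y (fst p)" for p
  have Wb: "W \<in> measurable (borel \<Otimes>\<^sub>M borel) borel" unfolding W_def[abs_def] by measurable
  then have W: "W \<in> measurable (\<mu> \<Otimes>\<^sub>M \<nu>) borel" by (simp only: measurable_cong_sets[OF s refl])
  then have WP: "W \<in> measurable P borel" by (simp add: P)
  have hm: "h \<in> measurable \<mu> borel" using h by (simp add: Pk_measurable[OF \<mu>])
  have \<phi>m: "\<phi> \<in> borel_measurable borel"
    using convex_on_continuous[OF open_UNIV conv] by (rule borel_measurable_continuous_onI)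
  have A: "(\<lambda>x. ereal (\<phi> x)) \<in> Acx" by (rule convex_on_imp_Acx[OF conv])
  let ?\<kappa> = "distr P borel W"
  have K1: "?\<kappa> \<in> Pk 1" using P1(2) by (simp add: W_def[abs_def])
  \<comment> \<open>Jensen's inequality through an affine minorant that comes within
    \<open>e\<close> of \<open>\<phi>\<close> at the mean \<open>h x\<close>.\<close>
  have jensen: "\<phi> (h x) \<le> (\<integral>z. g x z * \<phi> (W (x, z)) \<partial>\<nu>)"
    if int: "integrable \<nu> (\<lambda>z. g x z * \<phi> (W (x, z)))" for x
  proof (rule field_le_epsilon)
    fix e :: real assume "e > 0"
    obtain v c where vc: "\<And>y. ereal (v \<bullet> y + c) \<le> ereal (\<phi> y)" and vx: "v \<bullet> h x + c > \<phi> (h x) - e"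
      using affine_minorant[OF A, of "h x" "\<phi> (h x)" e, OF refl \<open>e > 0\<close>] by metis
    have gint: "integrable \<nu> (g x)"
      using g\<nu>[of x] not_integrable_integral_eq by fastforce
    have eq: "g x z * (v \<bullet> W (x, z) + c) = v \<bullet> (g x z *\<^sub>R z) + (v \<bullet> h x - v \<bullet> Y x + c) * g x z" for z
      by (simp add: W_def inner_add_right inner_diff_right algebra_simps)
    have "(\<integral>z. g x z * (v \<bullet> W (x, z) + c) \<partial>\<nu>) = v \<bullet> Y x + (v \<bullet> h x - v \<bullet> Y x + c) * 1"
      unfolding eq g\<nu>[of x, symmetric] gY[of x, symmetric]
      by (subst Bochner_Integration.integral_add[OF integrable_inner_right integrable_mult_right])
        (use gi[of x] gint in \<open>simp_all only: integral_inner_right integral_mult_right_zero\<close>)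
    then have "v \<bullet> h x + c = (\<integral>z. g x z * (v \<bullet> W (x, z) + c) \<partial>\<nu>)" by simp
    also have "\<dots> \<le> (\<integral>z. g x z * \<phi> (W (x, z)) \<partial>\<nu>)"
    proof (rule integral_mono[OF _ int])
      show "integrable \<nu> (\<lambda>z. g x z * (v \<bullet> W (x, z) + c))"
        unfolding eq by (intro Bochner_Integration.integrable_add integrable_inner_right integrable_mult_right gi gint)
      show "g x z * (v \<bullet> W (x, z) + c) \<le> g x z * \<phi> (W (x, z))" for z
        using vc[of "W (x, z)"] g0 by (intro mult_left_mono) auto
    qed
    finally show "\<phi> (h x) \<le> (\<integral>z. g x z * \<phi> (W (x, z)) \<partial>\<nu>) + e" using vx by linarith
  qed
  obtain v c where vc: "\<And>y. ereal (v \<bullet> y + c) \<le> ereal (\<phi> y)"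
    using affine_minorant[OF A, of 0 "\<phi> 0" 1, OF refl zero_less_one] by metis
  have "(\<lambda>x. ereal (\<phi> x)) \<in> borel_measurable ?\<kappa>" using \<phi>m by simp
  then have "eint (distr \<mu> borel h) (\<lambda>x. ereal (\<phi> x)) \<le> eint ?\<kappa> (\<lambda>x. ereal (\<phi> x))"
    using integrable_affine[OF K1] vc
  proof (cases rule: eint_infinite_or_integrable)
    case 1
    then show ?thesis by simp
  next
    case 2
    then have \<phi>\<kappa>: "integrable ?\<kappa> \<phi>" by simp
    then have "integrable P (\<lambda>p. \<phi> (W p))" by (simp add: integrable_distr_eq[OF WP \<phi>m])
    then have i: "integrable (\<mu> \<Otimes>\<^sub>M \<nu>) (\<lambda>p. g (fst p) (snd p) * \<phi> (W p))"
      unfolding P using g0 \<phi>m W by (subst (asm) integrable_density) auto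
    have "integral\<^sup>L ?\<kappa> \<phi> = (\<integral>p. \<phi> (W p) \<partial>P)" by (rule integral_distr[OF WP \<phi>m])
    also have "\<dots> = (\<integral>p. g (fst p) (snd p) * \<phi> (W p) \<partial>(\<mu> \<Otimes>\<^sub>M \<nu>))"
      unfolding P using g0 \<phi>m W by (subst integral_density) auto
    also have "\<dots> = (\<integral>x. (\<integral>z. g x z * \<phi> (W (x, z)) \<partial>\<nu>) \<partial>\<mu>)"
      using integral_fst'[OF i] by simp
    finally have \<kappa>: "integral\<^sup>L ?\<kappa> \<phi> = (\<integral>x. (\<integral>z. g x z * \<phi> (W (x, z)) \<partial>\<nu>) \<partial>\<mu>)" .
    have ii: "integrable \<mu> (\<lambda>x. \<integral>z. g x z * \<phi> (W (x, z)) \<partial>\<nu>)"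
      using integrable_fst'[OF i] by simp
    have ae: "AE x in \<mu>. \<phi> (h x) \<le> (\<integral>z. g x z * \<phi> (W (x, z)) \<partial>\<nu>)"
      using AE_integrable_fst'[OF i] by eventually_elim (auto intro: jensen)
    have hi: "integrable \<mu> (\<lambda>x. v \<bullet> h x + c)"
      using integrable_affine[OF P1(1), of v c] by (subst (asm) integrable_distr_eq[OF hm]) auto
    \<comment> \<open>Integrability follows by sandwiching between the affine minorant and the inner
      integral from \<open>jensen\<close>.\<close>
    have ph: "integrable \<mu> (\<lambda>x. \<phi> (h x))"
    proof (rule Bochner_Integration.integrable_bound)
      show "integrable \<mu> (\<lambda>x. \<bar>v \<bullet> h x + c\<bar> + \<bar>\<integral>z. g x z * \<phi> (W (x, z)) \<partial>\<nu>\<bar>)"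
        by (rule Bochner_Integration.integrable_add[OF integrable_abs[OF hi] integrable_abs[OF ii]])
      show "(\<lambda>x. \<phi> (h x)) \<in> borel_measurable \<mu>" using hm \<phi>m by measurable
      show "AE x in \<mu>. norm (\<phi> (h x)) \<le> norm (\<bar>v \<bullet> h x + c\<bar> + \<bar>\<integral>z. g x z * \<phi> (W (x, z)) \<partial>\<nu>\<bar>)"
        using ae
      proof eventually_elim
        case (elim x)
        have "v \<bullet> h x + c \<le> \<phi> (h x)" using vc[of "h x"] by simp
        with elim show ?case unfolding real_norm_def by linarith
      qed
    qed
    have "eint (distr \<mu> borel h) (\<lambda>x. ereal (\<phi> x)) = ereal (\<integral>x. \<phi> (h x) \<partial>\<mu>)"
      using ph \<phi>m hm by (subst eint_eq_integral[of _ \<phi>]) (auto simp: integrable_distr_eq integral_distr)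
    also have "\<dots> \<le> ereal (integral\<^sup>L ?\<kappa> \<phi>)"
      unfolding \<kappa> ereal_less_eq by (rule integral_mono_AE[OF ph ii ae])
    also have "\<dots> = eint ?\<kappa> (\<lambda>x. ereal (\<phi> x))"
      using \<phi>\<kappa> by (subst eint_eq_integral[of _ \<phi>]) auto
    finally show ?thesis .
  qed
  then show "eint (distr \<mu> borel h) (\<lambda>x. ereal (\<phi> x))
      \<le> eint (distr P borel (\<lambda>p. h (fst p) + snd p - Y (fst p))) (\<lambda>x. ereal (\<phi> x))"
    by (simp add: W_def[abs_def])
qed

text \<open>For every slack \<open>\<epsilon>\<close> a single joint law \<open>P\<close> yields a
  competitor for each problem, and both costs reduce to the mean square of \<open>x - Y x\<close>
  under \<open>\<mu>\<close>.\<close>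

lemma strong_duality:
  fixes \<mu> \<nu> :: "('a::euclidean_space) measure"
  assumes \<mu>: "\<mu> \<in> Pk 2" and \<nu>: "\<nu> \<in> Pk 2"
    and H: "\<And>(I::'a set) a b. finite I \<Longrightarrow> I \<noteq> {} \<Longrightarrow>
      (\<integral>x. max_affine I a (\<lambda>i. b i - (norm (a i))\<^sup>2 / 4) x \<partial>\<mu>) - (\<integral>z. max_affine I a b z \<partial>\<nu>) \<le> D"
  shows "T2_to_set \<mu> (cx_below 2 \<nu>) \<le> ereal D" and "T2_from_set (cx_above 2 \<mu>) \<nu> \<le> ereal D"
proof -
  interpret \<mu>: prob_space \<mu> using PkD(1)[OF \<mu>] .
  have "T2_to_set \<mu> (cx_below 2 \<nu>) \<le> ereal D + ereal \<epsilon> \<and> T2_from_set (cx_above 2 \<mu>) \<nu> \<le> ereal D + ereal \<epsilon>"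
    if \<epsilon>: "0 < \<epsilon>" for \<epsilon>
  proof -
    obtain g :: "'a \<Rightarrow> 'a \<Rightarrow> real" and Y :: "'a \<Rightarrow> 'a"
      where gm: "(\<lambda>p. g (fst p) (snd p)) \<in> borel_measurable (borel \<Otimes>\<^sub>M borel)"
        and g0: "\<And>x z. 0 \<le> g x z"
        and Y: "Y \<in> borel_measurable borel" and fin: "finite (range Y)"
        and g\<nu>: "\<And>x. (\<integral>z. g x z \<partial>\<nu>) = 1" and g\<mu>: "\<And>z. (\<integral>x. g x z \<partial>\<mu>) = 1"
        and gi: "\<And>x. integrable \<nu> (\<lambda>z. g x z *\<^sub>R z)" and gY: "\<And>x. (\<integral>z. g x z *\<^sub>R z \<partial>\<nu>) = Y x"
        and cost: "(\<integral>x. (norm (x - Y x))\<^sup>2 \<partial>\<mu>) \<le> D + \<epsilon>"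
    proof (rule transport_kernel[OF \<mu> \<nu> _ \<epsilon>])
      show "(\<integral>x. max_affine I a (\<lambda>i. b i - (norm (a i))\<^sup>2 / 4) x \<partial>\<mu>) - (\<integral>z. max_affine I a b z \<partial>\<nu>) \<le> D"
        if "finite I" "I \<noteq> {}" for I :: "'a set" and a b using that by (rule H)
    qed (rule that)
    define P where "P = density (\<mu> \<Otimes>\<^sub>M \<nu>) (\<lambda>p. ennreal (g (fst p) (snd p)))"
    note J = kernel_joint_law[OF \<mu> \<nu> gm g0 g\<nu> g\<mu> P_def]
    note cx = le_cx_kernel[OF \<mu> \<nu> gm g0 g\<nu> gi gY P_def Y]
    interpret P: prob_space P by (rule J(2))
    have mP: "f \<in> measurable P N \<longleftrightarrow> f \<in> measurable (borel \<Otimes>\<^sub>M borel) N" for f and N :: "'c measure"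
      unfolding borel_prod by (simp only: measurable_cong_sets[OF J(1) refl])
    have fstP: "fst \<in> measurable P borel" and sndP: "snd \<in> measurable P borel"
      unfolding mP by measurable
    have Y\<mu>: "Y \<in> measurable \<mu> borel" using Y by (simp add: Pk_measurable[OF \<mu>])
    obtain B where B: "\<And>x. norm (Y x) \<le> B"
      using finite_imp_bounded[OF fin] by (auto simp: bounded_iff)
    have Ym: "(\<lambda>x. (norm (x - Y x))\<^sup>2) \<in> borel_measurable borel" using Y by measurable
    have ci: "integrable \<mu> (\<lambda>x. (norm (x - Y x))\<^sup>2)"
    proof (rule integrable_quadratic_growth[OF \<mu> Ym])
      fix x
      have "(norm (Y x))\<^sup>2 \<le> B\<^sup>2" using B by (intro power_mono) auto
      moreover have "(norm (x - Y x))\<^sup>2 \<le> 2 * (norm x)\<^sup>2 + 2 * (norm (Y x))\<^sup>2"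
        using norm_diff_square_le[of "x - Y x" x] by simp
      moreover have "0 \<le> B\<^sup>2 * (norm x)\<^sup>2" by simp
      ultimately show "\<bar>(norm (x - Y x))\<^sup>2\<bar> \<le> (2 + 2 * B\<^sup>2) * (1 + (norm x)\<^sup>2)"
        unfolding abs_power2 distrib_left distrib_right by linarith
    qed
    have cost': "enn2ereal (\<integral>\<^sup>+x. ennreal ((norm (x - Y x))\<^sup>2) \<partial>\<mu>) \<le> ereal D + ereal \<epsilon>"
      using cost by (simp add: nn_integral_eq_integral[OF ci] enn2ereal_ennreal)
    have \<mu>eq: "distr P borel fst = \<mu>" and \<nu>eq: "distr P borel snd = \<nu>" by (rule J(3), rule J(4))

    let ?\<eta> = "distr \<mu> borel Y"
    have \<eta>2: "?\<eta> \<in> Pk 2"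
      using B Y\<mu> unfolding Pk_def
      by (auto intro!: \<mu>.prob_space_distr \<mu>.integrable_const_bound[of _ "B\<^sup>2"] AE_I2 power_mono
          simp: integrable_distr_eq)
    \<comment> \<open>With \<open>h = Y\<close> the shifted variable reduces to the second
      coordinate.\<close>
    have \<nu>eq': "distr P borel (\<lambda>p. Y (fst p) + snd p - Y (fst p)) = \<nu>"
      using \<nu>eq by simp
    have "le_cx ?\<eta> (distr P borel (\<lambda>p. Y (fst p) + snd p - Y (fst p)))"
      using \<eta>2 \<nu> Pk_mono unfolding \<nu>eq' by (intro cx[OF Y, unfolded \<nu>eq']) auto
    then have \<eta>: "?\<eta> \<in> cx_below 2 \<nu>" using \<eta>2 unfolding \<nu>eq' by (simp add: cx_below_def)
    let ?\<pi> = "distr \<mu> borel (\<lambda>x. (x, Y x))"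
    have pm: "(\<lambda>x. (x, Y x)) \<in> measurable \<mu> borel"
      unfolding borel_prod[symmetric] Pk_measurable[OF \<mu>] using Y by measurable
    have fb: "fst \<in> measurable (borel :: ('a \<times> 'a) measure) borel" "snd \<in> measurable (borel :: ('a \<times> 'a) measure) borel"
      unfolding borel_prod[symmetric] by measurable
    have "?\<pi> \<in> couplings \<mu> ?\<eta>"
      unfolding couplings_def using pm fb PkD(2)[OF \<mu>]
      by (auto intro!: \<mu>.prob_space_distr simp: distr_distr o_def distr_id2)
    then have "T2 \<mu> ?\<eta> \<le> enn2ereal (\<integral>\<^sup>+ p. ennreal ((norm (fst p - snd p))\<^sup>2) \<partial>?\<pi>)"
      unfolding T2_def by (rule INF_lower)
    also have "(\<integral>\<^sup>+ p. ennreal ((norm (fst p - snd p))\<^sup>2) \<partial>?\<pi>) = (\<integral>\<^sup>+x. ennreal ((norm (x - Y x))\<^sup>2) \<partial>\<mu>)"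
      using fb by (subst nn_integral_distr[OF pm]) auto
    also note cost'
    finally have to: "T2_to_set \<mu> (cx_below 2 \<nu>) \<le> ereal D + ereal \<epsilon>"
      unfolding T2_to_set_def by (rule INF_lower2[OF \<eta>])

    \<comment> \<open>Pairing \<open>W\<close> with the second coordinate gives the displacement
      \<open>fst p - Y (fst p)\<close>, so the cost is the same as in the first problem.\<close>
    define W where "W = (\<lambda>p. fst p + snd p - Y (fst p))"
    let ?\<xi> = "distr P borel W"
    let ?\<rho> = "distr P borel (\<lambda>p. (W p, snd p))"
    have W: "W \<in> measurable P borel" unfolding mP W_def using Y by measurable
    have Wp: "(\<lambda>p. (W p, snd p)) \<in> measurable P borel"
      unfolding borel_prod[symmetric] using W sndP by measurable
    have \<rho>: "?\<rho> \<in> couplings ?\<xi> \<nu>"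
      unfolding couplings_def using Wp fb \<nu>eq
      by (auto intro!: P.prob_space_distr simp: distr_distr o_def)
    have nm: "(\<lambda>p. (norm (fst p - snd p))\<^sup>2) \<in> borel_measurable (borel :: ('a \<times> 'a) measure)"
      using fb by measurable
    have cP: "integrable P (\<lambda>p. (norm (fst p - Y (fst p)))\<^sup>2)"
      using ci unfolding \<mu>eq[symmetric] by (simp add: integrable_distr_eq[OF fstP Ym])
    have c\<rho>: "integrable ?\<rho> (\<lambda>p. (norm (fst p - snd p))\<^sup>2)"
      unfolding integrable_distr_eq[OF Wp nm] using cP by (simp add: W_def)
    have "prob_space ?\<xi>" using W by (rule P.prob_space_distr)
    then have \<xi>2: "?\<xi> \<in> Pk 2"
      using couplings_second_moment[OF \<rho> c\<rho>] PkD(4)[OF \<nu>] by (simp add: Pk_def)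
    have id: "distr \<mu> borel (\<lambda>x. x) = \<mu>" using PkD(2)[OF \<mu>, symmetric] by (rule distr_id2)
    have "le_cx (distr \<mu> borel (\<lambda>x. x)) (distr P borel (\<lambda>p. fst p + snd p - Y (fst p)))"
      using \<xi>2 \<mu> Pk_mono by (intro cx) (auto simp: id W_def)
    then have \<xi>: "?\<xi> \<in> cx_above 2 \<mu>" using \<xi>2 by (simp add: cx_above_def id W_def)
    have "T2 ?\<xi> \<nu> \<le> enn2ereal (\<integral>\<^sup>+ p. ennreal ((norm (fst p - snd p))\<^sup>2) \<partial>?\<rho>)"
      unfolding T2_def using \<rho> by (rule INF_lower)
    also have "(\<integral>\<^sup>+ p. ennreal ((norm (fst p - snd p))\<^sup>2) \<partial>?\<rho>)
        = (\<integral>\<^sup>+ p. ennreal ((norm (fst p - Y (fst p)))\<^sup>2) \<partial>P)"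
      using nm by (subst nn_integral_distr[OF Wp]) (auto simp: W_def)
    also have "\<dots> = (\<integral>\<^sup>+x. ennreal ((norm (x - Y x))\<^sup>2) \<partial>distr P borel fst)"
      using Ym by (subst nn_integral_distr[OF fstP]) auto
    also note \<mu>eq
    also note cost'
    finally have "T2_from_set (cx_above 2 \<mu>) \<nu> \<le> ereal D + ereal \<epsilon>"
      unfolding T2_from_set_def by (rule INF_lower2[OF \<xi>])
    with to show ?thesis by simp
  qed
  then show "T2_to_set \<mu> (cx_below 2 \<nu>) \<le> ereal D" and "T2_from_set (cx_above 2 \<mu>) \<nu> \<le> ereal D"
    by (auto intro: ereal_le_epsilon2)
qed

section \<open>Admissibility and dual values of maxima of affine functions\<close>

lemma convex_on_max_affine:
  assumes "finite I" "I \<noteq> {}"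
  shows "convex_on UNIV (max_affine I a b)"
proof (rule convex_on_def[THEN iffD2], intro conjI ballI allI impI convex_UNIV)
  fix x y and u v :: real assume uv: "0 \<le> u" "0 \<le> v" "u + v = 1"
  obtain i where i: "i \<in> I" "max_affine I a b (u *\<^sub>R x + v *\<^sub>R y) = a i \<bullet> (u *\<^sub>R x + v *\<^sub>R y) + b i"
    using max_affine_attained[OF assms] .
  have "b i = u * b i + v * b i" using uv(3) by (metis distrib_right mult_1)
  then have "max_affine I a b (u *\<^sub>R x + v *\<^sub>R y) = u * (a i \<bullet> x + b i) + v * (a i \<bullet> y + b i)"
    unfolding i(2) by (simp add: inner_add_right algebra_simps)
  also have "\<dots> \<le> u * max_affine I a b x + v * max_affine I a b y"
    using uv by (intro add_mono mult_left_mono max_affine_ge[OF assms(1) i(1)])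
  finally show "max_affine I a b (u *\<^sub>R x + v *\<^sub>R y) \<le> u * max_affine I a b x + v * max_affine I a b y" .
qed

lemma max_affine_Acx_Cbk:
  fixes a :: "'i \<Rightarrow> 'a::euclidean_space"
  assumes I: "finite I" "I \<noteq> {}" and k: "k \<in> {1, 2::nat}"
  shows "(\<lambda>x. ereal (max_affine I a b x)) \<in> Acx \<inter> Cbk k"
proof
  note conv = convex_on_max_affine[OF I, of a b]
  show "(\<lambda>x. ereal (max_affine I a b x)) \<in> Acx" by (rule convex_on_imp_Acx[OF conv])
  let ?C = "\<Sum>i\<in>I. norm (a i) + \<bar>b i\<bar>"
  have C: "?C \<ge> 0" by (intro sum_nonneg) auto
  have "\<bar>max_affine I a b x\<bar> \<le> (2 * ?C) * (1 + norm x ^ k)" for x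
  proof -
    have "norm x ^ 1 \<le> 1 + norm x ^ k" "0 \<le> norm x ^ k"
      using k by (intro power_le_one_plus_power) auto
    then have "1 + norm x \<le> 2 * (1 + norm x ^ k)" unfolding distrib_left power_one_right by linarith
    then have "?C * (1 + norm x) \<le> ?C * (2 * (1 + norm x ^ k))" using C by (rule mult_left_mono)
    also have "\<dots> = (2 * ?C) * (1 + norm x ^ k)" by (simp only: mult.assoc mult.left_commute)
    finally show ?thesis using max_affine_bound[OF I, of a b x] by linarith
  qed
  then show "(\<lambda>x. ereal (max_affine I a b x)) \<in> Cbk k"
    using convex_on_continuous[OF open_UNIV conv] by (auto simp: Cbk_def)
qed

text \<open>This one inequality gives both dual estimates: the infimum over \<open>y\<close> bounds
  \<open>Q2\<close> of the right-hand potential from below, and the supremum over \<open>x\<close>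
  bounds \<open>Q2bar\<close> of the left-hand one from above. It holds for the affine piece active
  at \<open>x\<close>, by \<open>inner_le_quadratic\<close>.\<close>

lemma max_affine_conjugate_le:
  fixes a :: "'i \<Rightarrow> 'a::real_inner"
  assumes I: "finite I" "I \<noteq> {}"
  shows "max_affine I a (\<lambda>i. b i - (norm (a i))\<^sup>2 / 4) x \<le> max_affine I a b y + (norm (x - y))\<^sup>2"
proof -
  obtain i where i: "i \<in> I" "max_affine I a (\<lambda>i. b i - (norm (a i))\<^sup>2 / 4) x = a i \<bullet> x + (b i - (norm (a i))\<^sup>2 / 4)"
    using max_affine_attained[OF I] .
  then show ?thesis
    using max_affine_ge[OF I(1) i(1), of a y b] inner_le_quadratic[of 1 "a i" x y] by simp
qed

lemma eint_ge_integral: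
  assumes "f \<in> borel_measurable M" "integrable M g" "\<And>x. ereal (g x) \<le> f x"
  shows "ereal (integral\<^sup>L M g) \<le> eint M f"
  using assms
proof (cases rule: eint_infinite_or_integrable)
  case 2
  have "integral\<^sup>L M g \<le> (\<integral>x. real_of_ereal (f x) \<partial>M)"
    using 2(2) by (intro integral_mono_AE assms(2) 2(1), eventually_elim) (metis assms(3) ereal_less_eq(3))
  then show ?thesis using eint_eq_integral[OF 2] by simp
qed simp

lemma eint_le_integral:
  assumes f: "f \<in> borel_measurable M" and l: "integrable M l" "\<And>x. ereal (l x) \<le> f x"
    and g: "integrable M g" "\<And>x. f x \<le> ereal (g x)"
  shows "eint M f \<le> ereal (integral\<^sup>L M g)"
proof -
  define r where "r x = real_of_ereal (f x)" for x
  have r: "f x = ereal (r x)" for x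
    using l(2)[of x] g(2)[of x] by (cases "f x") (auto simp: r_def)
  have b: "l x \<le> r x" "r x \<le> g x" for x using l(2)[of x] g(2)[of x] by (simp_all add: r)
  have i: "integrable M r"
  proof (rule Bochner_Integration.integrable_bound)
    show "integrable M (\<lambda>x. \<bar>l x\<bar> + \<bar>g x\<bar>)" using l(1) g(1) by simp
    show "r \<in> borel_measurable M" unfolding r_def[abs_def] using f by measurable
    show "AE x in M. norm (r x) \<le> norm (\<bar>l x\<bar> + \<bar>g x\<bar>)"
    proof (rule AE_I2)
      fix x show "norm (r x) \<le> norm (\<bar>l x\<bar> + \<bar>g x\<bar>)"
        using b[of x] unfolding real_norm_def by linarith
    qed
  qed
  have "eint M f = ereal (integral\<^sup>L M r)" using i by (rule eint_eq_integral) (simp add: r)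
  also have "\<dots> \<le> ereal (integral\<^sup>L M g)" using integral_mono[OF i g(1) b(2)] by simp
  finally show ?thesis .
qed

text \<open>The first problem is tested with \<open>\<phi>\<close> and the second with
  \<open>\<psi>\<close>, yet the lower bound is the same number; hence the two halves of
  \<open>strong_duality\<close> share one form of hypothesis.\<close>

lemma max_affine_dual_value:
  fixes \<mu> \<nu> :: "('a::euclidean_space) measure" and a :: "'i \<Rightarrow> 'a" and b :: "'i \<Rightarrow> real"
  assumes \<mu>: "\<mu> \<in> Pk 2" and \<nu>: "\<nu> \<in> Pk 2" and I: "finite I" "I \<noteq> {}"
  defines "\<phi> \<equiv> max_affine I a b" and "\<psi> \<equiv> max_affine I a (\<lambda>i. b i - (norm (a i))\<^sup>2 / 4)"
  shows "ereal (integral\<^sup>L \<mu> \<psi> - integral\<^sup>L \<nu> \<phi>) \<le> eint \<mu> (Q2 (\<lambda>x. ereal (\<phi> x))) - eint \<nu> (\<lambda>x. ereal (\<phi> x))"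
    and "ereal (integral\<^sup>L \<mu> \<psi> - integral\<^sup>L \<nu> \<phi>) \<le> eint \<mu> (\<lambda>x. ereal (\<psi> x)) - eint \<nu> (Q2bar (\<lambda>x. ereal (\<psi> x)))"
proof -
  have i: "integrable M \<phi>" "integrable M \<psi>" if "M \<in> Pk 2" for M
    unfolding \<phi>_def \<psi>_def using max_affine_integrable[OF I that] by auto
  have e: "eint M (\<lambda>x. ereal (f x)) = ereal (integral\<^sup>L M f)" if "integrable M f" for f and M :: "'a measure"
    using that by (intro eint_eq_integral) auto
  have le: "\<psi> x \<le> \<phi> y + (norm (x - y))\<^sup>2" for x y
    unfolding \<phi>_def \<psi>_def by (rule max_affine_conjugate_le[OF I])
  have "ereal (integral\<^sup>L \<mu> \<psi>) \<le> eint \<mu> (Q2 (\<lambda>x. ereal (\<phi> x)))"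
  proof (rule eint_ge_integral)
    show "Q2 (\<lambda>x. ereal (\<phi> x)) \<in> borel_measurable \<mu>"
      by (simp add: Pk_measurable[OF \<mu>] Q2_measurable)
    show "ereal (\<psi> x) \<le> Q2 (\<lambda>x. ereal (\<phi> x)) x" for x
      unfolding Q2_def using le by (intro INF_greatest) simp
  qed (rule i[OF \<mu>])
  then show "ereal (integral\<^sup>L \<mu> \<psi> - integral\<^sup>L \<nu> \<phi>) \<le> eint \<mu> (Q2 (\<lambda>x. ereal (\<phi> x))) - eint \<nu> (\<lambda>x. ereal (\<phi> x))"
    using ereal_minus_mono[of "ereal (integral\<^sup>L \<mu> \<psi>)"] e[OF i(1)[OF \<nu>]]
    by (metis ereal_minus(1) order_refl)
  have "eint \<nu> (Q2bar (\<lambda>x. ereal (\<psi> x))) \<le> ereal (integral\<^sup>L \<nu> \<phi>)"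
  proof (rule eint_le_integral[where l = \<psi>])
    show "Q2bar (\<lambda>x. ereal (\<psi> x)) \<in> borel_measurable \<nu>"
      by (simp add: Pk_measurable[OF \<nu>] Q2bar_measurable)
    show "ereal (\<psi> y) \<le> Q2bar (\<lambda>x. ereal (\<psi> x)) y" for y
      unfolding Q2bar_def by (intro SUP_upper2[of y]) auto
    show "Q2bar (\<lambda>x. ereal (\<psi> x)) y \<le> ereal (\<phi> y)" for y
      unfolding Q2bar_def
    proof (rule SUP_least)
      fix x show "ereal (\<psi> x) - ereal ((norm (x - y))\<^sup>2) \<le> ereal (\<phi> y)" using le[of x y] by simp
    qed
  qed (rule i[OF \<nu>])+
  then show "ereal (integral\<^sup>L \<mu> \<psi> - integral\<^sup>L \<nu> \<phi>) \<le> eint \<mu> (\<lambda>x. ereal (\<psi> x)) - eint \<nu> (Q2bar (\<lambda>x. ereal (\<psi> x)))"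
    using ereal_minus_mono[of "ereal (integral\<^sup>L \<mu> \<psi>)" "ereal (integral\<^sup>L \<mu> \<psi>)"] e[OF i(2)[OF \<mu>]]
    by (metis ereal_minus(1) order_refl)
qed

text \<open>\<open>strong_duality\<close> takes a real bound \<open>D\<close>. A dual supremum equal
  to infinity is trivial, and the real lower bound \<open>r\<close> excludes minus infinity.\<close>

lemma le_ereal_of_finite_bounds:
  fixes S T :: ereal
  assumes "ereal r \<le> S" and "\<And>D. S = ereal D \<Longrightarrow> T \<le> ereal D"
  shows "T \<le> S"
  using assms by (cases S) auto

section \<open>Inclusions between the classes of potentials and conclusion\<close>

lemma Sbk_subset_Sbk_2:
  assumes "k \<in> {1, 2::nat}"
  shows "Sbk k \<subseteq> Sbk 2"
proof
  fix f :: "'a \<Rightarrow> ereal" assume f: "f \<in> Sbk k"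
  then obtain C where C: "\<And>x. \<bar>real_of_ereal (f x)\<bar> \<le> C * (1 + norm x ^ k)" by (auto simp: Sbk_def)
  have "\<bar>real_of_ereal (f x)\<bar> \<le> (2 * \<bar>C\<bar>) * (1 + norm x ^ 2)" for x
  proof -
    have "norm x ^ k \<le> 1 + norm x ^ 2" "0 \<le> norm x ^ 2"
      using assms by (intro power_le_one_plus_power) auto
    then have "1 + norm x ^ k \<le> 2 * (1 + norm x ^ 2)" unfolding distrib_left by linarith
    then have "\<bar>C\<bar> * (1 + norm x ^ k) \<le> \<bar>C\<bar> * (2 * (1 + norm x ^ 2))" by (intro mult_left_mono) auto
    moreover have "C * (1 + norm x ^ k) \<le> \<bar>C\<bar> * (1 + norm x ^ k)" by (intro mult_right_mono) auto
    ultimately show ?thesis using C[of x] by (simp add: mult.assoc mult.left_commute)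
  qed
  then show "f \<in> Sbk 2" using f by (auto simp: Sbk_def)
qed

lemma Sbk_subset_L1e:
  fixes \<nu> :: "('a::euclidean_space) measure"
  assumes \<nu>: "\<nu> \<in> Pk 2"
  shows "Sbk 2 \<subseteq> L1e \<nu>"
proof
  fix f :: "'a \<Rightarrow> ereal" assume f: "f \<in> Sbk 2"
  define F where "F = (\<lambda>x. real_of_ereal (f x))"
  have fF: "f = (\<lambda>x. ereal (F x))" using f by (auto simp: Sbk_def F_def ereal_real)
  have Fm: "F \<in> borel_measurable borel" using f by (auto simp: Sbk_def F_def)
  obtain C where "\<And>x. \<bar>F x\<bar> \<le> C * (1 + (norm x)\<^sup>2)" using f by (auto simp: Sbk_def F_def)
  then have i: "integrable \<nu> F" by (rule integrable_quadratic_growth[OF \<nu> Fm])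
  then have "(\<integral>\<^sup>+ x. ennreal \<bar>F x\<bar> \<partial>\<nu>) < \<infinity>"
    unfolding integrable_iff_bounded by simp
  then show "f \<in> L1e \<nu>"
    using Fm by (simp add: L1e_def fF Pk_measurable[OF \<nu>])
qed

lemma Cbk_subset_Sbk: "Cbk k \<subseteq> Sbk k"
  by (auto simp: Cbk_def Sbk_def intro: borel_measurable_continuous_onI)

theorem mainTheorem8:
  fixes \<mu> \<nu> :: "('a::euclidean_space) measure"
  assumes "\<mu> \<in> Pk 2" and "\<nu> \<in> Pk 2"
  shows "\<forall>k \<in> {1, 2::nat}.
      T2_to_set \<mu> (cx_below 1 \<nu>) = T2_to_set \<mu> (cx_below 2 \<nu>)
    \<and> T2_to_set \<mu> (cx_below 1 \<nu>) = (SUP \<phi> \<in> Acx \<inter> Cbk k. eint \<mu> (Q2 \<phi>) - eint \<nu> \<phi>)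
    \<and> T2_to_set \<mu> (cx_below 1 \<nu>) = (SUP \<phi> \<in> Acx \<inter> L1e \<nu>. eint \<mu> (Q2 \<phi>) - eint \<nu> \<phi>)
    \<and> T2_to_set \<mu> (cx_below 1 \<nu>) = (SUP \<phi> \<in> Acx \<inter> Sbk k. eint \<mu> (Q2 \<phi>) - eint \<nu> \<phi>)
    \<and> T2_from_set (cx_above 1 \<mu>) \<nu> = T2_from_set (cx_above 2 \<mu>) \<nu>
    \<and> T2_from_set (cx_above 1 \<mu>) \<nu> = (SUP \<phi> \<in> Acx \<inter> Cbk k. eint \<mu> \<phi> - eint \<nu> (Q2bar \<phi>))
    \<and> T2_from_set (cx_above 1 \<mu>) \<nu> = (SUP \<phi> \<in> Acx \<inter> Sbk k. eint \<mu> \<phi> - eint \<nu> (Q2bar \<phi>))"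
proof
  fix k :: nat assume k: "k \<in> {1, 2}"
  define below where "below A = (SUP \<phi> \<in> Acx \<inter> A. eint \<mu> (Q2 \<phi>) - eint \<nu> \<phi>)" for A
  define above where "above A = (SUP \<phi> \<in> Acx \<inter> A. eint \<mu> \<phi> - eint \<nu> (Q2bar \<phi>))" for A
  let ?gap = "\<lambda>(I::'a set) a b. (\<integral>x. max_affine I a (\<lambda>i. b i - (norm (a i))\<^sup>2 / 4) x \<partial>\<mu>)
    - (\<integral>z. max_affine I a b z \<partial>\<nu>)"
  have gap_below: "ereal (?gap I a b) \<le> below (Cbk k)" if "finite I" "I \<noteq> {}" for I a b
    unfolding below_def
    using SUP_upper[OF max_affine_Acx_Cbk[OF that k], of "\<lambda>\<phi>. eint \<mu> (Q2 \<phi>) - eint \<nu> \<phi>"]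
    by (rule order_trans[OF max_affine_dual_value(1)[OF assms that]])
  have gap_above: "ereal (?gap I a b) \<le> above (Cbk k)" if "finite I" "I \<noteq> {}" for I a b
    unfolding above_def
    using SUP_upper[OF max_affine_Acx_Cbk[OF that k], of "\<lambda>\<phi>. eint \<mu> \<phi> - eint \<nu> (Q2bar \<phi>)"]
    by (rule order_trans[OF max_affine_dual_value(2)[OF assms that]])
  have Pk_le: "M \<in> Pk 2 \<Longrightarrow> M \<in> Pk 1" for M :: "'a measure" using Pk_mono by auto
  \<comment> \<open>\<open>b1\<close> to \<open>b5\<close> form a cycle through both primal values
    and the three dual suprema of part (i), and \<open>a1\<close> to \<open>a4\<close> form one for
    part (ii), so every inequality in them is an equality.\<close>
  have b1: "T2_to_set \<mu> (cx_below 1 \<nu>) \<le> T2_to_set \<mu> (cx_below 2 \<nu>)"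
    unfolding T2_to_set_def using Pk_le by (intro INF_superset_mono) (auto simp: cx_below_def)
  \<comment> \<open>The index set \<open>{0}\<close> is just some nonempty finite set: one affine
    function already keeps the supremum above minus infinity.\<close>
  have b2: "T2_to_set \<mu> (cx_below 2 \<nu>) \<le> below (Cbk k)"
  proof (rule le_ereal_of_finite_bounds[OF gap_below[of "{0}"]])
    fix D assume "below (Cbk k) = ereal D"
    then show "T2_to_set \<mu> (cx_below 2 \<nu>) \<le> ereal D"
      using gap_below by (intro strong_duality(1)[OF assms]) fastforce
  qed auto
  have b3: "below (Cbk k) \<le> below (Sbk k)"
    unfolding below_def using Cbk_subset_Sbk by (intro SUP_subset_mono) auto
  have b4: "below (Sbk k) \<le> below (L1e \<nu>)"
    unfolding below_def using Sbk_subset_Sbk_2[OF k] Sbk_subset_L1e[OF assms(2)]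
    by (intro SUP_subset_mono) auto
  have b5: "below (L1e \<nu>) \<le> T2_to_set \<mu> (cx_below 1 \<nu>)"
    unfolding below_def T2_to_set_def T2_def
    using weak_duality_below[OF assms] by (intro SUP_least INF_greatest)
  have a1: "T2_from_set (cx_above 1 \<mu>) \<nu> \<le> T2_from_set (cx_above 2 \<mu>) \<nu>"
    unfolding T2_from_set_def using Pk_le by (intro INF_superset_mono) (auto simp: cx_above_def)
  have a2: "T2_from_set (cx_above 2 \<mu>) \<nu> \<le> above (Cbk k)"
  proof (rule le_ereal_of_finite_bounds[OF gap_above[of "{0}"]])
    fix D assume "above (Cbk k) = ereal D"
    then show "T2_from_set (cx_above 2 \<mu>) \<nu> \<le> ereal D"
      using gap_above by (intro strong_duality(2)[OF assms]) fastforce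
  qed auto
  have a3: "above (Cbk k) \<le> above (Sbk k)"
    unfolding above_def using Cbk_subset_Sbk by (intro SUP_subset_mono) auto
  have a4: "above (Sbk k) \<le> T2_from_set (cx_above 1 \<mu>) \<nu>"
    unfolding above_def T2_from_set_def T2_def
    using weak_duality_above[OF assms] Sbk_subset_Sbk_2[OF k] by (intro SUP_least INF_greatest) blast
  show "T2_to_set \<mu> (cx_below 1 \<nu>) = T2_to_set \<mu> (cx_below 2 \<nu>)
    \<and> T2_to_set \<mu> (cx_below 1 \<nu>) = (SUP \<phi> \<in> Acx \<inter> Cbk k. eint \<mu> (Q2 \<phi>) - eint \<nu> \<phi>)
    \<and> T2_to_set \<mu> (cx_below 1 \<nu>) = (SUP \<phi> \<in> Acx \<inter> L1e \<nu>. eint \<mu> (Q2 \<phi>) - eint \<nu> \<phi>)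
    \<and> T2_to_set \<mu> (cx_below 1 \<nu>) = (SUP \<phi> \<in> Acx \<inter> Sbk k. eint \<mu> (Q2 \<phi>) - eint \<nu> \<phi>)
    \<and> T2_from_set (cx_above 1 \<mu>) \<nu> = T2_from_set (cx_above 2 \<mu>) \<nu>
    \<and> T2_from_set (cx_above 1 \<mu>) \<nu> = (SUP \<phi> \<in> Acx \<inter> Cbk k. eint \<mu> \<phi> - eint \<nu> (Q2bar \<phi>))
    \<and> T2_from_set (cx_above 1 \<mu>) \<nu> = (SUP \<phi> \<in> Acx \<inter> Sbk k. eint \<mu> \<phi> - eint \<nu> (Q2bar \<phi>))"
    unfolding below_def[symmetric] above_def[symmetric]
    using b1 b2 b3 b4 b5 a1 a2 a3 a4 by (intro conjI antisym) (blast intro: order_trans)+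
qed

end
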